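(* Let $n\ge1$. Then $T_n'^a(\iota_n(x))=T_n'^f(x)\in R^f$ for all $x\in\mathrm{TL}_n(R^f)$.
   Context: Rings. $R_0^f=\mathbb{Z}[z]\subset R^f=\mathbb{Z}[A^{\pm1}]$ via $z=-A^2-A^{-2}$; $R_0^a=\mathbb{Z}[z_0,z_1,z_2,\dots]\subset R^a=\mathbb{Z}[A^{\pm1},z_1,z_2,\dots]$ via $z_0=-A^2-A^{-2}$; $R^f$ is a subring of $R^a$. Let $V_n=\{0,1\}\times\{1,\dots,n\}$, ordered by $(0,1)<(0,2)<\cdots<(0,n)<(1,n)<\cdots<(1,2)<(1,1)$. A flat virtual $n$-tangle is a partition of $V_n$ into pairs; $\mathcal{E}_n$ is the set of these. Virtual Temperley--Lieb algebra. $\mathrm{VTL}_n(R^f)$ is the free $R^f$-module with basis $\mathcal{E}_n$ and bilinear multiplication: for $E,E'\in\mathcal{E}_n$, view pairs as arcs and glue the point $(1,i)$ of $E$ to the point $(0,i)$ of $E'$ for each $i$; the result consists of $n$ arcs with endpoints the points $(0,i)$ of $E$ and $(1,i)$ of $E'$, determining $E*E'\in\mathcal{E}_n$, and $m$ closed curves; $E\,E'=z^m(E*E')$. $T_n'^f:\mathrm{VTL}_n(R^f)\to R^f$ is the $R^f$-linear map with $T_n'^f(E)=z^{t_n(E)}$ for $E\in\mathcal{E}_n$, where $t_n(E)$ is the number of closed curves obtained from the arcs of $E$ by joining $(0,i)$ to $(1,i)$ by an additional arc for every $i$. Temperley--Lieb algebra. $\mathrm{TL}_n(R^f)=R^f\otimes\mathrm{TL}_n$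 is the $R^f$-algebra presented by generators $E_1,\dots,E_{n-1}$ and relations $E_i^2=zE_i$, $E_iE_j=E_jE_i$ for $|i-j|\ge2$, $E_iE_jE_i=E_i$ for $|i-j|=1$ (for $n=1$ it is $R^f$). It embeds in $\mathrm{VTL}_n(R^f)$ by sending $E_i$ to the flat virtual tangle $\{\{(0,i),(0,i+1)\},\{(1,i),(1,i+1)\}\}\cup\{\{(0,k),(1,k)\}\mid k\ne i,i+1\}$ (Kauffman), and is viewed as a subalgebra of $\mathrm{VTL}_n(R^f)$; this is the meaning of $T_n'^f(x)$ for $x\in\mathrm{TL}_n(R^f)$. Arrow Temperley--Lieb algebra. An arrow flat $n$-tangle is a pair $F=(E,f)$ with $E\in\mathcal{E}_n$ and $f:E\to\mathbb{Z}$ such that, for $\alpha=\{(a,b),(c,d)\}\in E$, $f(\alpha)$ is odd if $a=c$ and even if $a\ne c$. $\mathcal{F}_n$ is the set of these and $\mathrm{ATL}_n(R^a)$ is the free $R^a$-module with basis $\mathcal{F}_n$, with the following multiplication. For $E,E'\in\mathcal{E}_n$, an arc of length $\ell$ in $E\sqcup E'$ is an $\ell$-tuple $\hat\alpha=(\alpha_1,\dots,\alpha_\ell)$ of elements of $E\sqcup E'$, $\alpha_i=\{(a_i,b_{i-1}),(c_i,b_i)\}$, such that: (a) if $\alpha_i\in E$ and $i<\ell$, then $c_i=1$, $\alpha_{i+1}\in E'$ and $a_{i+1}=0$; (b) if $\alpha_i\in E'$ and $i<\ell$, then $c_i=0$, $\alpha_{i+1}\in E$ and $a_{i+1}=1$;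 (c) $a_1=0$ if $\alpha_1\in E$, $a_1=1$ if $\alpha_1\in E'$, $c_\ell=0$ if $\alpha_\ell\in E$, $c_\ell=1$ if $\alpha_\ell\in E'$, and $(a_1,b_0)<(c_\ell,b_\ell)$. Its boundary is $\partial\hat\alpha=\{(a_1,b_0),(c_\ell,b_\ell)\}$; the boundaries of the $n$ arcs form $E*E'$. A cycle of length $2p\ge2$ in $E\sqcup E'$ is a $2p$-tuple $\hat\gamma=(\gamma_1,\dots,\gamma_{2p})$, $\gamma_i=\{(a_i,b_{i-1}),(c_i,b_i)\}$, such that $\gamma_i\in E$ and $a_i=c_i=1$ for $i$ odd, $\gamma_i\in E'$ and $a_i=c_i=0$ for $i$ even, and $b_0=b_{2p}<b_i$ for $1\le i\le 2p-1$. The parity of $\alpha=\{(a,b),(c,d)\}$ is $\varpi(\alpha)=-1$ if $a=c$ and $1$ if $a\ne c$. For an arc or cycle $(\alpha_1,\dots,\alpha_\ell)$ with $\alpha_i=\{(a_i,b_{i-1}),(c_i,b_i)\}$ (also for the cycles in a closure, defined below), the cumulated parity is $\varpi^c(\alpha_i)=\prod_{j=1}^{i-1}\varpi(\alpha_j)$ if $(a_i,b_{i-1})<(c_i,b_i)$, and $\varpi^c(\alpha_i)=\prod_{j=1}^{i}\varpi(\alpha_j)$ if $(c_i,b_i)<(a_i,b_{i-1})$. For $F=(E,f)$, $F'=(E',f')\in\mathcal{F}_n$ let $f^*$ equal $f$ on $E$ and $f'$ on $E'$. Put $g(\partial\hat\alpha)=\sum_{i}\varpi^c(\alpha_i)f^*(\alpha_i)$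 for each arc, and $F*F'=(E*E',g)$; for each cycle put $h(\hat\gamma)=\sum_i\varpi^c(\gamma_i)f^*(\gamma_i)$ (even) and $\zeta(\hat\gamma)=|h(\hat\gamma)|/2$. If $\hat\gamma_1,\dots,\hat\gamma_m$ are the cycles of $E\sqcup E'$, then $F\,F'=z_{\zeta(\hat\gamma_1)}\cdots z_{\zeta(\hat\gamma_m)}(F*F')$. This is an associative unital algebra. For $1\le i\le n-1$, $F_i\in\mathcal{F}_n$ has pairs $\{(0,i),(0,i+1)\}$ and $\{(1,i),(1,i+1)\}$ both labeled $1$, and $\{(0,k),(1,k)\}$ labeled $0$ for $k\ne i,i+1$. $\iota_n:\mathrm{TL}_n(R^f)\to\mathrm{ATL}_n(R^a)$ is the (injective) $R^f$-algebra homomorphism which sends $E_i$ to $F_i$ for all $i$. Trace. For $E\in\mathcal{E}_n$, a cycle of length $\ell$ in the closure $\hat E$ is an $\ell$-tuple $\hat\gamma=(\gamma_1,\dots,\gamma_\ell)$ in $E$, $\gamma_i=\{(a_i,b_{i-1}),(c_i,b_i)\}$, such that $a_{i+1}=1$ if $c_i=0$ and $a_{i+1}=0$ if $c_i=1$, for $1\le i\le\ell-1$; and $b_0=b_\ell<b_i$ for $1\le i\le\ell-1$, $a_1=0$, $c_\ell=1$. For $F=(E,f)\in\mathcal{F}_n$ put $h(\hat\gamma)=\sum_{i=1}^\ell\varpi^c(\gamma_i)f(\gamma_i)$ (even) and $\zeta(\hat\gamma)=|h(\hat\gamma)|/2$. If $\hat\gamma_1,\dots,\hat\gamma_m$ are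 the cycles of $\hat E$, $T_n'^a(F)=z_{\zeta(\hat\gamma_1)}\cdots z_{\zeta(\hat\gamma_m)}$, extended $R^a$-linearly to $T_n'^a:\mathrm{ATL}_n(R^a)\to R^a$. *)

theory Defs
  imports
    "HOL-Library.Poly_Mapping"
    "HOL-Library.Disjoint_Sets"
    "HOL-Algebra.QuotRing"
begin

text \<open>
  \<open>Rf\<close> is the group ring of the integers, i.e. the ring of Laurent polynomials in \<open>A\<close>, where
  \<open>A^k\<close> is \<open>Poly_Mapping.single k 1\<close>.  \<open>Ra\<close> is the polynomial ring over \<open>Rf\<close> in
  countably many variables; variable number \<open>k\<close> is \<open>z\<^bsub>k+1\<^esub>\<close>, since \<open>z\<^sub>0\<close> is not a variable.
\<close>

type_synonym Rf = "int \<Rightarrow>\<^sub>0 int"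
type_synonym Ra = "(nat \<Rightarrow>\<^sub>0 nat) \<Rightarrow>\<^sub>0 Rf"

definition zf :: Rf where
  "zf = - Poly_Mapping.single 2 1 - Poly_Mapping.single (- 2) 1"

definition Rf_to_Ra :: "Rf \<Rightarrow> Ra" where
  "Rf_to_Ra c = Poly_Mapping.single 0 c"

fun za :: "nat \<Rightarrow> Ra" where
  "za 0 = Rf_to_Ra zf"
| "za (Suc k) = Poly_Mapping.single (Poly_Mapping.single k 1) 1"

definition scale :: "'r::comm_ring_1 \<Rightarrow> ('k \<Rightarrow>\<^sub>0 'r) \<Rightarrow> ('k \<Rightarrow>\<^sub>0 'r)" where
  "scale c x = Poly_Mapping.map ((*) c) x"

text \<open>The algebra which is free as a module on \<open>B\<close>, with the product of basis elements given by
  \<open>m\<close> and with unit the basis element \<open>e\<close>.\<close>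

definition basis_algebra ::
  "'k set \<Rightarrow> ('k \<Rightarrow> 'k \<Rightarrow> ('k \<Rightarrow>\<^sub>0 'r::comm_ring_1)) \<Rightarrow> 'k \<Rightarrow> ('k \<Rightarrow>\<^sub>0 'r) ring" where
  "basis_algebra B m e =
    \<lparr>carrier = {x. Poly_Mapping.keys x \<subseteq> B},
     mult = (\<lambda>x y. \<Sum>a\<in>Poly_Mapping.keys x. \<Sum>b\<in>Poly_Mapping.keys y.
               scale (Poly_Mapping.lookup x a * Poly_Mapping.lookup y b) (m a b)),
     one = Poly_Mapping.single e 1,
     zero = 0,
     add = (+)\<rparr>"

type_synonym pt = "nat \<times> nat"
type_synonym tangle = "pt set set"

definition pts :: "nat \<Rightarrow> pt set" where
  "pts n = {0, 1} \<times> {1..n}"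

definition pt_less :: "pt \<Rightarrow> pt \<Rightarrow> bool" where
  "pt_less p q \<longleftrightarrow>
    fst p < fst q \<or> (fst p = fst q \<and> (if fst p = 0 then snd p < snd q else snd q < snd p))"

definition tangles :: "nat \<Rightarrow> tangle set" where
  "tangles n = {E. partition_on (pts n) E \<and> (\<forall>\<alpha>\<in>E. card \<alpha> = 2)}"

definition id_tangle :: "nat \<Rightarrow> tangle" where
  "id_tangle n = {{(0, k), (1, k)} | k. k \<in> {1..n}}"

definition gen_tangle :: "nat \<Rightarrow> nat \<Rightarrow> tangle" where
  "gen_tangle n i =
    {{(0, i), (0, i + 1)}, {(1, i), (1, i + 1)}} \<union>
    {{(0, k), (1, k)} | k. k \<in> {1..n} \<and> k \<noteq> i \<and> k \<noteq> i + 1}"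

text \<open>In \<open>E \<squnion> E'\<close>, elements and points of \<open>E\<close> are tagged \<open>Lft\<close>, those of \<open>E'\<close> are tagged
  \<open>Rgt\<close>.\<close>

datatype side = Lft | Rgt

text \<open>Adjacency in the 1-complex obtained by gluing \<open>(1,i)\<close> of \<open>E\<close> to \<open>(0,i)\<close> of \<open>E'\<close>.  Its
  connected components are the classes of the reflexive transitive closure: the closed curves are
  the components without free end, the arcs are the others.\<close>

definition glue_adj :: "nat \<Rightarrow> tangle \<Rightarrow> tangle \<Rightarrow> (side \<times> pt) rel" where
  "glue_adj n E E' =
    {((Lft, p), (Lft, q)) | p q. {p, q} \<in> E} \<union>
    {((Rgt, p), (Rgt, q)) | p q. {p, q} \<in> E'} \<union>
    {((Lft, (1, i)), (Rgt, (0, i))) | i. i \<in> {1..n}} \<union>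
    {((Rgt, (0, i)), (Lft, (1, i))) | i. i \<in> {1..n}}"

definition free_end :: "pt \<Rightarrow> side \<times> pt" where
  "free_end p = (if fst p = 0 then (Lft, p) else (Rgt, p))"

definition tangle_star :: "nat \<Rightarrow> tangle \<Rightarrow> tangle \<Rightarrow> tangle" where
  "tangle_star n E E' =
    {{p, q} | p q. p \<in> pts n \<and> q \<in> pts n \<and> p \<noteq> q \<and>
       (free_end p, free_end q) \<in> (glue_adj n E E')\<^sup>*}"

definition glue_loops :: "nat \<Rightarrow> tangle \<Rightarrow> tangle \<Rightarrow> nat" where
  "glue_loops n E E' =
    card {C \<in> (UNIV \<times> pts n) // (glue_adj n E E')\<^sup>*. C \<inter> free_end ` pts n = {}}"

definition closure_adj :: "nat \<Rightarrow> tangle \<Rightarrow> pt rel" where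
  "closure_adj n E =
    {(p, q). {p, q} \<in> E} \<union>
    {((0, i), (1, i)) | i. i \<in> {1..n}} \<union> {((1, i), (0, i)) | i. i \<in> {1..n}}"

definition closure_loops :: "nat \<Rightarrow> tangle \<Rightarrow> nat" where
  "closure_loops n E = card (pts n // (closure_adj n E)\<^sup>*)"

definition VTL :: "nat \<Rightarrow> (tangle \<Rightarrow>\<^sub>0 Rf) ring" where
  "VTL n = basis_algebra (tangles n)
    (\<lambda>E E'. Poly_Mapping.single (tangle_star n E E') (zf ^ glue_loops n E E'))
    (id_tangle n)"

definition trace_f :: "nat \<Rightarrow> (tangle \<Rightarrow>\<^sub>0 Rf) \<Rightarrow> Rf" where
  "trace_f n x = (\<Sum>E\<in>Poly_Mapping.keys x. Poly_Mapping.lookup x E * zf ^ closure_loops n E)"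

text \<open>
  A tuple with entries \<open>\<alpha>\<^sub>i = {(a\<^sub>i, b\<^bsub>i-1\<^esub>), (c\<^sub>i, b\<^sub>i)}\<close> is the list of the triples
  \<open>(s\<^sub>i, (a\<^sub>i, b\<^bsub>i-1\<^esub>), (c\<^sub>i, b\<^sub>i))\<close>, where \<open>s\<^sub>i\<close> tells whether \<open>\<alpha>\<^sub>i\<close> lies in \<open>E\<close> or in \<open>E'\<close>;
  list positions start at 0.  The conditions on arcs and cycles determine the points
  \<open>(a\<^sub>i, b\<^bsub>i-1\<^esub>)\<close> and \<open>(c\<^sub>i, b\<^sub>i)\<close> from the tuple \<open>(\<alpha>\<^sub>1, \<dots>, \<alpha>\<^sub>l)\<close>, so lists and tuples
  correspond bijectively.  For tuples in a single \<open>E\<close> the tag is the unit element.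
\<close>

type_synonym 's walk = "('s \<times> pt \<times> pt) list"

abbreviation tag :: "'s walk \<Rightarrow> nat \<Rightarrow> 's" where
  "tag w i \<equiv> fst (w ! i)"

abbreviation src :: "'s walk \<Rightarrow> nat \<Rightarrow> pt" where
  "src w i \<equiv> fst (snd (w ! i))"

abbreviation tgt :: "'s walk \<Rightarrow> nat \<Rightarrow> pt" where
  "tgt w i \<equiv> snd (snd (w ! i))"

abbreviation edge :: "'s walk \<Rightarrow> nat \<Rightarrow> pt set" where
  "edge w i \<equiv> {src w i, tgt w i}"

definition is_arc :: "tangle \<Rightarrow> tangle \<Rightarrow> side walk \<Rightarrow> bool" where
  "is_arc E E' w \<longleftrightarrow>
    w \<noteq> [] \<and>
    (\<forall>i<length w. edge w i \<in> (case tag w i of Lft \<Rightarrow> E | Rgt \<Rightarrow> E')) \<and>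
    (\<forall>i. Suc i < length w \<longrightarrow>
      snd (src w (Suc i)) = snd (tgt w i) \<and>
      (tag w i = Lft \<longrightarrow>
        fst (tgt w i) = 1 \<and> tag w (Suc i) = Rgt \<and> fst (src w (Suc i)) = 0) \<and>
      (tag w i = Rgt \<longrightarrow>
        fst (tgt w i) = 0 \<and> tag w (Suc i) = Lft \<and> fst (src w (Suc i)) = 1)) \<and>
    fst (src w 0) = (case tag w 0 of Lft \<Rightarrow> 0 | Rgt \<Rightarrow> 1) \<and>
    fst (tgt w (length w - 1)) = (case tag w (length w - 1) of Lft \<Rightarrow> 0 | Rgt \<Rightarrow> 1) \<and>
    pt_less (src w 0) (tgt w (length w - 1))"

definition boundary :: "'s walk \<Rightarrow> pt set" where
  "boundary w = {src w 0, tgt w (length w - 1)}"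

definition is_cycle :: "tangle \<Rightarrow> tangle \<Rightarrow> side walk \<Rightarrow> bool" where
  "is_cycle E E' w \<longleftrightarrow>
    w \<noteq> [] \<and> even (length w) \<and>
    (\<forall>i<length w.
      if even i then tag w i = Lft \<and> edge w i \<in> E \<and> fst (src w i) = 1 \<and> fst (tgt w i) = 1
      else tag w i = Rgt \<and> edge w i \<in> E' \<and> fst (src w i) = 0 \<and> fst (tgt w i) = 0) \<and>
    (\<forall>i. Suc i < length w \<longrightarrow>
      snd (src w (Suc i)) = snd (tgt w i) \<and> snd (src w 0) < snd (tgt w i)) \<and>
    snd (src w 0) = snd (tgt w (length w - 1))"

definition is_closure_cycle :: "tangle \<Rightarrow> unit walk \<Rightarrow> bool" where
  "is_closure_cycle E w \<longleftrightarrow>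
    w \<noteq> [] \<and>
    (\<forall>i<length w. edge w i \<in> E) \<and>
    (\<forall>i. Suc i < length w \<longrightarrow>
      snd (src w (Suc i)) = snd (tgt w i) \<and>
      (fst (tgt w i) = 0 \<longrightarrow> fst (src w (Suc i)) = 1) \<and>
      (fst (tgt w i) = 1 \<longrightarrow> fst (src w (Suc i)) = 0) \<and>
      snd (src w 0) < snd (tgt w i)) \<and>
    snd (src w 0) = snd (tgt w (length w - 1)) \<and>
    fst (src w 0) = 0 \<and> fst (tgt w (length w - 1)) = 1"

definition parity :: "pt set \<Rightarrow> int" where
  "parity \<alpha> = (if \<exists>a b d. \<alpha> = {(a, b), (a, d)} then - 1 else 1)"

definition cumulated_parity :: "'s walk \<Rightarrow> nat \<Rightarrow> int" where
  "cumulated_parity w i =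
    (if pt_less (src w i) (tgt w i) then \<Prod>j<i. parity (edge w j)
     else \<Prod>j\<le>i. parity (edge w j))"

definition label_sum :: "('s \<Rightarrow> pt set \<Rightarrow> int) \<Rightarrow> 's walk \<Rightarrow> int" where
  "label_sum f w = (\<Sum>i<length w. cumulated_parity w i * f (tag w i) (edge w i))"

definition zeta :: "('s \<Rightarrow> pt set \<Rightarrow> int) \<Rightarrow> 's walk \<Rightarrow> nat" where
  "zeta f w = nat \<bar>label_sum f w\<bar> div 2"

type_synonym arrow_tangle = "tangle \<times> (pt set \<Rightarrow> int)"

definition arrow_tangles :: "nat \<Rightarrow> arrow_tangle set" where
  "arrow_tangles n =
    {(E, f). E \<in> tangles n \<and> f \<in> E \<rightarrow>\<^sub>E UNIV \<and>
       (\<forall>a b c d. {(a, b), (c, d)} \<in> E \<longrightarrow> (odd (f {(a, b), (c, d)}) \<longleftrightarrow> a = c))}"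

definition id_arrow_tangle :: "nat \<Rightarrow> arrow_tangle" where
  "id_arrow_tangle n = (id_tangle n, \<lambda>\<alpha>\<in>id_tangle n. 0)"

definition gen_arrow_tangle :: "nat \<Rightarrow> nat \<Rightarrow> arrow_tangle" where
  "gen_arrow_tangle n i =
    (gen_tangle n i,
     \<lambda>\<alpha>\<in>gen_tangle n i. if \<alpha> \<in> {{(0, i), (0, i + 1)}, {(1, i), (1, i + 1)}} then 1 else 0)"

definition join_labels ::
  "(pt set \<Rightarrow> int) \<Rightarrow> (pt set \<Rightarrow> int) \<Rightarrow> side \<Rightarrow> pt set \<Rightarrow> int" where
  "join_labels f f' s = (case s of Lft \<Rightarrow> f | Rgt \<Rightarrow> f')"

definition arrow_star :: "nat \<Rightarrow> arrow_tangle \<Rightarrow> arrow_tangle \<Rightarrow> arrow_tangle" where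
  "arrow_star n = (\<lambda>(E, f) (E', f').
    (tangle_star n E E',
     \<lambda>\<beta>\<in>tangle_star n E E'.
       THE k. \<exists>w. is_arc E E' w \<and> boundary w = \<beta> \<and> k = label_sum (join_labels f f') w))"

definition arrow_coeff :: "arrow_tangle \<Rightarrow> arrow_tangle \<Rightarrow> Ra" where
  "arrow_coeff = (\<lambda>(E, f) (E', f').
    \<Prod>w\<in>{w. is_cycle E E' w}. za (zeta (join_labels f f') w))"

definition ATL :: "nat \<Rightarrow> (arrow_tangle \<Rightarrow>\<^sub>0 Ra) ring" where
  "ATL n = basis_algebra (arrow_tangles n)
    (\<lambda>F F'. Poly_Mapping.single (arrow_star n F F') (arrow_coeff F F'))
    (id_arrow_tangle n)"

definition arrow_closure_coeff :: "arrow_tangle \<Rightarrow> Ra" where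
  "arrow_closure_coeff = (\<lambda>(E, f).
    \<Prod>w\<in>{w. is_closure_cycle E w}. za (zeta (\<lambda>_. f) w))"

definition trace_a :: "nat \<Rightarrow> (arrow_tangle \<Rightarrow>\<^sub>0 Ra) \<Rightarrow> Ra" where
  "trace_a n x =
    (\<Sum>F\<in>Poly_Mapping.keys x. Poly_Mapping.lookup x F * arrow_closure_coeff F)"

text \<open>The free algebra has as basis the words in the letters \<open>1, \<dots>, n - 1\<close>, the letter \<open>i\<close>
  standing for \<open>E\<^sub>i\<close>.\<close>

definition free_algebra :: "nat \<Rightarrow> (nat list \<Rightarrow>\<^sub>0 Rf) ring" where
  "free_algebra n = basis_algebra (lists {1..<n}) (\<lambda>u v. Poly_Mapping.single (u @ v) 1) []"

definition TL_relators :: "nat \<Rightarrow> (nat list \<Rightarrow>\<^sub>0 Rf) set" where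
  "TL_relators n =
    {Poly_Mapping.single [i, i] 1 - Poly_Mapping.single [i] zf | i. i \<in> {1..<n}} \<union>
    {Poly_Mapping.single [i, j] 1 - Poly_Mapping.single [j, i] 1 | i j.
       i \<in> {1..<n} \<and> j \<in> {1..<n} \<and> \<bar>int i - int j\<bar> \<ge> 2} \<union>
    {Poly_Mapping.single [i, j, i] 1 - Poly_Mapping.single [i] 1 | i j.
       i \<in> {1..<n} \<and> j \<in> {1..<n} \<and> \<bar>int i - int j\<bar> = 1}"

definition TL :: "nat \<Rightarrow> (nat list \<Rightarrow>\<^sub>0 Rf) set ring" where
  "TL n = free_algebra n Quot (genideal (free_algebra n) (TL_relators n))"

text \<open>\<open>eval_poly \<phi> A g\<close> is the algebra homomorphism from the free algebra to \<open>A\<close> that sends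
  the letter \<open>i\<close> to \<open>g i\<close>, where scalars act on \<open>A\<close> through \<open>\<phi>\<close>; \<open>TL_hom \<phi> A g\<close> is the
  homomorphism induced by it on the quotient.\<close>

definition eval_poly ::
  "(Rf \<Rightarrow> 'r::comm_ring_1) \<Rightarrow> ('k \<Rightarrow>\<^sub>0 'r) ring \<Rightarrow> (nat \<Rightarrow> ('k \<Rightarrow>\<^sub>0 'r)) \<Rightarrow>
    (nat list \<Rightarrow>\<^sub>0 Rf) \<Rightarrow> ('k \<Rightarrow>\<^sub>0 'r)" where
  "eval_poly \<phi> A g p =
    (\<Sum>u\<in>Poly_Mapping.keys p.
      scale (\<phi> (Poly_Mapping.lookup p u)) (foldr (\<lambda>i y. g i \<otimes>\<^bsub>A\<^esub> y) u \<one>\<^bsub>A\<^esub>))"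

definition TL_hom ::
  "(Rf \<Rightarrow> 'r::comm_ring_1) \<Rightarrow> ('k \<Rightarrow>\<^sub>0 'r) ring \<Rightarrow> (nat \<Rightarrow> ('k \<Rightarrow>\<^sub>0 'r)) \<Rightarrow>
    (nat list \<Rightarrow>\<^sub>0 Rf) set \<Rightarrow> ('k \<Rightarrow>\<^sub>0 'r)" where
  "TL_hom \<phi> A g X = the_elem (eval_poly \<phi> A g ` X)"

definition TL_to_VTL :: "nat \<Rightarrow> (nat list \<Rightarrow>\<^sub>0 Rf) set \<Rightarrow> (tangle \<Rightarrow>\<^sub>0 Rf)" where
  "TL_to_VTL n = TL_hom (\<lambda>c. c) (VTL n) (\<lambda>i. Poly_Mapping.single (gen_tangle n i) 1)"

definition iota :: "nat \<Rightarrow> (nat list \<Rightarrow>\<^sub>0 Rf) set \<Rightarrow> (arrow_tangle \<Rightarrow>\<^sub>0 Ra)" where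
  "iota n = TL_hom Rf_to_Ra (ATL n) (\<lambda>i. Poly_Mapping.single (gen_arrow_tangle n i) 1)"

end

theory Submission
  imports Defs Complex_Main "HOL-Combinatorics.Permutations"
begin

text \<open>
  Label the arc from \<open>p = (a,b)\<close> to \<open>q = (c,d)\<close>, \<open>p < q\<close>, of any flat tangle by \<open>(-1)\<^sup>a (d - b)\<close>.  With
  these labels the summand of an arc in a label sum, cumulated parity included, is a sign that is
  constant along the walk times the horizontal displacement of the arc.  So label sums telescope:
  they are canonical labels again for arcs of a product, and vanish for cycles.  The
  generators \<open>F\<^sub>i\<close> are canonically labelled, hence \<open>\<iota>\<close> replaces every tangle by its canonically labelled
  version, every \<open>\<zeta>\<close> is \<open>0\<close>, and both traces count the components of the closure.

  Products of generators are computed by letting words act from the left on matchings.  Since this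
  action satisfies the Temperley--Lieb relations, its kernel is an ideal containing the relators, so
  that the maps from the quotient are well defined without associativity of the target algebras.
\<close>

section \<open>Linear extension\<close>

text \<open>Two different notions of closed curve have to be reconciled: \<open>VTL\<close> counts
  connected components, while \<open>ATL\<close> multiplies over tuples with a prescribed start and
  direction. Vanishing of \<open>zeta\<close> alone does not settle the claim; each component must
  carry exactly one admissible tuple. For products this can be read off directly, since evaluating a
  word only ever puts a generator on the left. For closures the danger is a component traversing one
  closing arc in both directions: the strict inequality on columns could then exclude every start.

  The shape of the labels is dictated by the generators. A vertical strand has label 0 and a
  turnback joins neighbouring columns with label 1, which suggests horizontal displacement; the
  order of the points is reversed on the side 1, which suggests the sign.

  \<open>linext\<close> takes the coefficient as an argument of \<open>f\<close> instead of a
  factor, so that it also covers maps that change the scalars along \<open>Rf_to_Ra\<close>.\<close>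

definition linext :: "('k \<Rightarrow> 'a::zero \<Rightarrow> 'b::comm_monoid_add) \<Rightarrow> ('k \<Rightarrow>\<^sub>0 'a) \<Rightarrow> 'b" where
  "linext f x = (\<Sum>k\<in>Poly_Mapping.keys x. f k (Poly_Mapping.lookup x k))"

lemma additive_single: "additive (Poly_Mapping.single k)"
  by (simp add: additive_def single_add)

lemma additive_id: "additive (\<lambda>x. x)"
  by (simp add: additive_def)

lemma additive_compose: "additive f \<Longrightarrow> additive g \<Longrightarrow> additive (\<lambda>x. f (g x))"
  by (simp add: additive_def)

lemma additive_mult_right: "additive (\<lambda>c. c * (d::'a::ring))"
  by (simp add: additive_def algebra_simps)

lemma additive_mult_left: "additive (\<lambda>c. (d::'a::ring) * c)"
  by (simp add: additive_def algebra_simps)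

lemma linext_single: "additive (f k) \<Longrightarrow> linext f (Poly_Mapping.single k c) = f k c"
  by (cases "c = 0") (simp_all add: linext_def additive.zero)

lemma additive_linext:
  assumes "\<And>k. additive (f k)"
  shows "additive (linext f)"
  unfolding additive_def linext_def
  by (intro allI setsum_keys_plus_distrib) (use assms in \<open>auto simp: additive.zero additive.add\<close>)

lemma additive_linext_param:
  assumes "\<And>k c. additive (\<lambda>d. f d k c)"
  shows "additive (\<lambda>d. linext (f d) x)"
  using assms unfolding additive_def linext_def by (simp add: sum.distrib)

text \<open>The test elements carry an arbitrary coefficient, so additivity replaces linearity and
  the two maps may change the ring of scalars. The set \<open>K\<close> allows identities that hold
  only for words in valid letters or only for matchings.\<close>

lemma additive_eqI:
  fixes F G :: "('a \<Rightarrow>\<^sub>0 'b::ab_group_add) \<Rightarrow> 'c::ab_group_add"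
  assumes "additive F" "additive G" "Poly_Mapping.keys x \<subseteq> K"
    and "\<And>k c. k \<in> K \<Longrightarrow> F (Poly_Mapping.single k c) = G (Poly_Mapping.single k c)"
  shows "F x = G x"
proof -
  have x: "(\<Sum>k\<in>Poly_Mapping.keys x. Poly_Mapping.single k (Poly_Mapping.lookup x k)) = x"
    by (rule poly_mapping_eqI) (simp add: lookup_sum lookup_single when_def sum.delta in_keys_iff)
  have *: "H x = (\<Sum>k\<in>Poly_Mapping.keys x. H (Poly_Mapping.single k (Poly_Mapping.lookup x k)))"
    if "additive H" for H :: "('a \<Rightarrow>\<^sub>0 'b) \<Rightarrow> 'c"
    using additive.sum[OF that, of "\<lambda>k. Poly_Mapping.single k (Poly_Mapping.lookup x k)" "Poly_Mapping.keys x"]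
    unfolding x .
  show ?thesis
    unfolding *[OF assms(1)] *[OF assms(2)] using assms(3,4) by (intro sum.cong) auto
qed

lemma additive_eqI':
  assumes "additive F" "additive G"
    and "\<And>k c. F (Poly_Mapping.single k c) = G (Poly_Mapping.single k c)"
  shows "F x = G x"
  using additive_eqI[of F G x UNIV] assms by simp

lemma scale_single: "scale c (Poly_Mapping.single k d) = Poly_Mapping.single k (c * d)"
  unfolding scale_def by (rule poly_mapping_eqI) (simp add: Poly_Mapping.map.rep_eq lookup_single when_def)

lemma basis_algebra_mult:
  "x \<otimes>\<^bsub>basis_algebra B m e\<^esub> y = linext (\<lambda>a c. linext (\<lambda>b d. scale (c * d) (m a b)) y) x"
  by (simp add: basis_algebra_def linext_def)

section \<open>The free algebra\<close>

definition word_mult :: "(nat list \<Rightarrow>\<^sub>0 Rf) \<Rightarrow> (nat list \<Rightarrow>\<^sub>0 Rf) \<Rightarrow> (nat list \<Rightarrow>\<^sub>0 Rf)" where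
  "word_mult x y = linext (\<lambda>u c. linext (\<lambda>v d. Poly_Mapping.single (u @ v) (c * d)) y) x"

lemma free_algebra_simps [simp]:
  "carrier (free_algebra n) = {x. Poly_Mapping.keys x \<subseteq> lists {1..<n}}"
  "x \<otimes>\<^bsub>free_algebra n\<^esub> y = word_mult x y"
  "\<one>\<^bsub>free_algebra n\<^esub> = Poly_Mapping.single [] 1"
  "\<zero>\<^bsub>free_algebra n\<^esub> = 0"
  "x \<oplus>\<^bsub>free_algebra n\<^esub> y = x + y"
  unfolding free_algebra_def basis_algebra_mult
  by (simp_all add: basis_algebra_def word_mult_def scale_single)

lemma additive_single_mult_right: "additive (\<lambda>c. Poly_Mapping.single k (c * (d::'a::ring)))"
  and additive_single_mult_left: "additive (\<lambda>c. Poly_Mapping.single k ((d::'a::ring) * c))"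
  by (simp_all add: additive_def algebra_simps single_add)

lemma additive_word_mult_left: "additive (\<lambda>x. word_mult x y)"
  unfolding word_mult_def
  by (intro additive_linext additive_linext_param additive_single_mult_right)

lemma additive_word_mult_right: "additive (word_mult x)"
proof -
  have "additive (\<lambda>y. linext (\<lambda>u c. linext (\<lambda>v d. Poly_Mapping.single (u @ v) (c * d)) y) x)"
    by (intro additive_linext_param additive_linext additive_single_mult_left)
  then show ?thesis
    unfolding word_mult_def .
qed

lemma word_mult_single:
  "word_mult (Poly_Mapping.single u c) (Poly_Mapping.single v d) = Poly_Mapping.single (u @ v) (c * d)"
  unfolding word_mult_def
  by (simp add: linext_single additive_linext_param additive_single_mult_right additive_single_mult_left)

lemma word_mult_assoc: "word_mult (word_mult x y) z = word_mult x (word_mult y z)"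
proof -
  let ?s = "Poly_Mapping.single"
  note L = additive_word_mult_left and R = additive_word_mult_right
  have 1: "word_mult (word_mult (?s u c) (?s v d)) z = word_mult (?s u c) (word_mult (?s v d) z)"
    for u c v d
    by (rule additive_eqI'[OF R additive_compose[OF R R]]) (simp add: word_mult_single mult.assoc)
  have 2: "word_mult (word_mult (?s u c) y) z = word_mult (?s u c) (word_mult y z)" for u c
    by (rule additive_eqI'[OF additive_compose[OF L R] additive_compose[OF R L]]) (rule 1)
  show ?thesis
    by (rule additive_eqI'[OF additive_compose[OF L L] L]) (rule 2)
qed

lemma word_mult_one_left: "word_mult (Poly_Mapping.single [] 1) x = x"
  by (rule additive_eqI'[of "word_mult (Poly_Mapping.single [] 1)" "\<lambda>x. x"])
    (simp_all add: word_mult_single additive_word_mult_right additive_id)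

lemma word_mult_one_right: "word_mult x (Poly_Mapping.single [] 1) = x"
  by (rule additive_eqI'[of "\<lambda>x. word_mult x (Poly_Mapping.single [] 1)" "\<lambda>x. x"])
    (simp_all add: word_mult_single additive_word_mult_left additive_id)

lemma keys_sum_subset:
  "(\<And>i. i \<in> I \<Longrightarrow> Poly_Mapping.keys (f i) \<subseteq> K) \<Longrightarrow> Poly_Mapping.keys (sum f I) \<subseteq> K"
  by (rule order_trans[OF keys_sum]) blast

lemma keys_word_mult:
  assumes "Poly_Mapping.keys x \<subseteq> lists S" "Poly_Mapping.keys y \<subseteq> lists S"
  shows "Poly_Mapping.keys (word_mult x y) \<subseteq> lists S"
  unfolding word_mult_def linext_def using assms
  by (intro keys_sum_subset) (auto split: if_splits)

lemma keys_add_subset: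
  "Poly_Mapping.keys x \<subseteq> K \<Longrightarrow> Poly_Mapping.keys y \<subseteq> K \<Longrightarrow> Poly_Mapping.keys (x + y) \<subseteq> K"
  using Poly_Mapping.keys_add[of x y] by blast

lemma ring_free_algebra: "ring (free_algebra n)"
proof (rule ringI)
  show "abelian_group (free_algebra n)"
  proof (rule abelian_groupI)
    fix x assume "x \<in> carrier (free_algebra n)"
    then show "\<exists>y\<in>carrier (free_algebra n). y \<oplus>\<^bsub>free_algebra n\<^esub> x = \<zero>\<^bsub>free_algebra n\<^esub>"
      by (intro bexI[of _ "- x"]) auto
  qed (simp_all add: add.assoc add.commute keys_add_subset)
  show "Group.monoid (free_algebra n)"
    by (rule monoidI)
      (simp_all add: word_mult_assoc word_mult_one_left word_mult_one_right keys_word_mult)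
qed (simp_all add: additive.add[OF additive_word_mult_left] additive.add[OF additive_word_mult_right])

section \<open>The action of words on matchings\<close>

text \<open>A flat tangle is encoded by the involution that exchanges the two ends of every arc.  Left
  multiplication by \<open>E\<^sub>i\<close> cuts the arcs ending in \<open>a = (0,i)\<close> and \<open>b = (0,i+1)\<close>, joins \<open>a\<close> to \<open>b\<close>
  and joins the loose ends; if \<open>a\<close> and \<open>b\<close> were already joined, the formula changes nothing.\<close>

definition reconnect :: "'a \<Rightarrow> 'a \<Rightarrow> ('a \<Rightarrow> 'a) \<Rightarrow> 'a \<Rightarrow> 'a" where
  "reconnect a b m = m(a := b, b := a, m a := m b, m b := m a)"

lemma reconnect_apply:
  "reconnect a b m x = (if x = m b then m a else if x = m a then m b
     else if x = b then a else if x = a then b else m x)"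
  by (auto simp: reconnect_def)

lemma reconnect_sym: "a \<noteq> b \<Longrightarrow> m a \<noteq> m b \<Longrightarrow> reconnect a b m = reconnect b a m"
  by (auto simp: reconnect_apply fun_eq_iff)

text \<open>The four points \<open>a\<close>, \<open>b\<close>, \<open>m a\<close>,
  \<open>m b\<close> are permuted among themselves and all others keep their partners. Preservation
  of fixed points is what keeps the result a matching of the same set.\<close>

lemma reconnect_involution:
  assumes inv: "\<And>x. m (m x) = x" and ne: "a \<noteq> b" "m a \<noteq> a" "m b \<noteq> b"
  shows "reconnect a b m (reconnect a b m x) = x" and "reconnect a b m x = x \<longleftrightarrow> m x = x"
proof -
  define A B where AB: "A = m a" "B = m b"
  have r: "m a = A" "m b = B" "m A = a" "m B = b"
    by (simp_all add: AB inv)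
  have d: "A \<noteq> B" "A \<noteq> a" "B \<noteq> b"
    using assms r by metis+
  note simps = r d d[symmetric] ne(1) ne(1)[symmetric]
  have other: "m x \<notin> {a, b, A, B}" if "x \<notin> {a, b, A, B}"
    using that inv r by auto metis+
  \<comment> \<open>The only coincidence left among the four points: \<open>a\<close> and
    \<open>b\<close> are already joined, and then both equations hold.\<close>
  have sw: "A = b \<longleftrightarrow> B = a"
    unfolding AB using inv by metis
  have cases: P if "A = b \<Longrightarrow> B = a \<Longrightarrow> P" "A \<noteq> b \<Longrightarrow> a \<noteq> B \<Longrightarrow> P" for P
    using that sw by blast
  consider "x = a" | "x = b" | "x = A" | "x = B" | "x \<notin> {a, b, A, B}" by auto
  then show "reconnect a b m (reconnect a b m x) = x"
    using other by cases (rule cases; simp add: reconnect_apply simps inv)+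
  consider "x = a" | "x = b" | "x = A" | "x = B" | "x \<notin> {a, b, A, B}" by auto
  then show "reconnect a b m x = x \<longleftrightarrow> m x = x"
    using other by cases (rule cases; simp add: reconnect_apply simps inv)+
qed

text \<open>This is the relation for distant generators. Only the total number of loops is compared:
  if \<open>c\<close> and \<open>d\<close> are joined in \<open>m\<close>, the loop closes at the
  first step in one order and at the second step in the other.\<close>

lemma reconnect_commute:
  assumes inv: "\<And>x. m (m x) = x"
    and ne: "a \<noteq> b" "a \<noteq> c" "a \<noteq> d" "b \<noteq> c" "b \<noteq> d" "c \<noteq> d"
    and fp: "m a \<noteq> a" "m b \<noteq> b" "m c \<noteq> c" "m d \<noteq> d"
  shows "reconnect a b (reconnect c d m) = reconnect c d (reconnect a b m)"
    and "of_bool (m c = d) + of_bool (reconnect c d m a = b)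
      = (of_bool (m a = b) + of_bool (reconnect a b m c = d) :: nat)"
proof -
  define A B C D where ABCD: "A = m a" "B = m b" "C = m c" "D = m d"
  have "m x = y \<longleftrightarrow> m y = x" for x y
    using inv by metis
  then have sw: "A = b \<longleftrightarrow> B = a" "A = c \<longleftrightarrow> C = a" "A = d \<longleftrightarrow> D = a"
    "B = c \<longleftrightarrow> C = b" "B = d \<longleftrightarrow> D = b" "C = d \<longleftrightarrow> D = c"
    unfolding ABCD by blast+
  have r: "m a = A" "m b = B" "m c = C" "m d = D" "m A = a" "m B = b" "m C = c" "m D = d"
    by (simp_all add: ABCD inv)
  have dist: "A \<noteq> B" "A \<noteq> C" "A \<noteq> D" "B \<noteq> C" "B \<noteq> D" "C \<noteq> D"
    "A \<noteq> a" "B \<noteq> b" "C \<noteq> c" "D \<noteq> d"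
    using ne fp r by metis+
  note simps = r dist dist[symmetric] ne ne[symmetric]
  \<comment> \<open>Successive splits on the partners of \<open>a\<close>, then \<open>b\<close>,
    then \<open>c\<close> decide every possible coincidence among the eight points.\<close>
  have cases1: P if "A = b \<Longrightarrow> B = a \<Longrightarrow> P" "A = c \<Longrightarrow> C = a \<Longrightarrow> P" "A = d \<Longrightarrow> D = a \<Longrightarrow> P"
    "A \<noteq> b \<Longrightarrow> b \<noteq> A \<Longrightarrow> A \<noteq> c \<Longrightarrow> c \<noteq> A \<Longrightarrow> A \<noteq> d \<Longrightarrow> d \<noteq> A \<Longrightarrow>
     B \<noteq> a \<Longrightarrow> a \<noteq> B \<Longrightarrow> C \<noteq> a \<Longrightarrow> a \<noteq> C \<Longrightarrow> D \<noteq> a \<Longrightarrow> a \<noteq> D \<Longrightarrow> P" for P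
    using that sw by blast
  have cases2: P if "B = c \<Longrightarrow> C = b \<Longrightarrow> P" "B = d \<Longrightarrow> D = b \<Longrightarrow> P"
    "B \<noteq> c \<Longrightarrow> c \<noteq> B \<Longrightarrow> B \<noteq> d \<Longrightarrow> d \<noteq> B \<Longrightarrow> C \<noteq> b \<Longrightarrow> b \<noteq> C \<Longrightarrow> D \<noteq> b \<Longrightarrow> b \<noteq> D \<Longrightarrow> P" for P
    using that sw by blast
  have cases3: P if "C = d \<Longrightarrow> D = c \<Longrightarrow> P" "C \<noteq> d \<Longrightarrow> d \<noteq> C \<Longrightarrow> D \<noteq> c \<Longrightarrow> c \<noteq> D \<Longrightarrow> P" for P
    using that sw by blast
  show "reconnect a b (reconnect c d m) = reconnect c d (reconnect a b m)"
  proof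
    fix x
    consider "x = a" | "x = b" | "x = c" | "x = d" | "x = A" | "x = B" | "x = C" | "x = D"
      | "x \<notin> {a, b, c, d, A, B, C, D}" by auto
    then show "reconnect a b (reconnect c d m) x = reconnect c d (reconnect a b m) x"
      by cases (rule cases1; rule cases2; rule cases3; insert simps; simp add: reconnect_apply split del: if_split)+
  qed
  show "of_bool (m c = d) + of_bool (reconnect c d m a = b)
      = (of_bool (m a = b) + of_bool (reconnect a b m c = d) :: nat)"
      by (rule cases1; rule cases2; rule cases3; insert simps; simp add: reconnect_apply split del: if_split)
qed

text \<open>The first step joins \<open>a\<close> to \<open>b\<close>. The second joins
  \<open>b\<close> to \<open>c\<close> and hands the partner of \<open>c\<close> to
  \<open>a\<close>; the third gives it back to \<open>c\<close>. When the second step begins,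
  \<open>b\<close> belongs to \<open>a\<close>, and when the third begins, \<open>b\<close> belongs
  to \<open>c\<close>, so neither closes a loop.\<close>

lemma reconnect_braid:
  assumes inv: "\<And>x. m (m x) = x"
    and ne: "a \<noteq> b" "a \<noteq> c" "b \<noteq> c"
    and fp: "m a \<noteq> a" "m b \<noteq> b" "m c \<noteq> c"
  shows "reconnect a b (reconnect b c (reconnect a b m)) = reconnect a b m"
    and "reconnect a b m b \<noteq> c" "reconnect b c (reconnect a b m) a \<noteq> b"
proof -
  define A B C where ABC: "A = m a" "B = m b" "C = m c"
  have "m x = y \<longleftrightarrow> m y = x" for x y
    using inv by metis
  then have sw: "A = b \<longleftrightarrow> B = a" "A = c \<longleftrightarrow> C = a" "B = c \<longleftrightarrow> C = b"
    unfolding ABC by blast+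
  have r: "m a = A" "m b = B" "m c = C" "m A = a" "m B = b" "m C = c"
    by (simp_all add: ABC inv)
  have dist: "A \<noteq> B" "A \<noteq> C" "B \<noteq> C" "A \<noteq> a" "B \<noteq> b" "C \<noteq> c"
    using ne fp r by metis+
  note simps = r dist dist[symmetric] ne ne[symmetric]
  have cases1: P if "A = b \<Longrightarrow> B = a \<Longrightarrow> P" "A = c \<Longrightarrow> C = a \<Longrightarrow> P"
    "A \<noteq> b \<Longrightarrow> b \<noteq> A \<Longrightarrow> A \<noteq> c \<Longrightarrow> c \<noteq> A \<Longrightarrow>
     B \<noteq> a \<Longrightarrow> a \<noteq> B \<Longrightarrow> C \<noteq> a \<Longrightarrow> a \<noteq> C \<Longrightarrow> P" for P
    using that sw by blast
  have cases2: P if "B = c \<Longrightarrow> C = b \<Longrightarrow> P"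
    "B \<noteq> c \<Longrightarrow> c \<noteq> B \<Longrightarrow> C \<noteq> b \<Longrightarrow> b \<noteq> C \<Longrightarrow> P" for P
    using that sw by blast
  show "reconnect a b (reconnect b c (reconnect a b m)) = reconnect a b m"
  proof
    fix x
    consider "x = a" | "x = b" | "x = c" | "x = A" | "x = B" | "x = C"
      | "x \<notin> {a, b, c, A, B, C}" by auto
    then show "reconnect a b (reconnect b c (reconnect a b m)) x = reconnect a b m x"
      by cases (rule cases1; rule cases2; insert simps; simp add: reconnect_apply split del: if_split)+
  qed
  show "reconnect a b m b \<noteq> c" "reconnect b c (reconnect a b m) a \<noteq> b"
      by (rule cases1; rule cases2; insert simps; simp add: reconnect_apply split del: if_split)+
qed

text \<open>The map is total and fixes exactly the points outside \<open>pts n\<close>. Hence the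
  involution law has no side condition, and relations between tangles become equalities of
  functions.\<close>

definition matching :: "nat \<Rightarrow> (pt \<Rightarrow> pt) \<Rightarrow> bool" where
  "matching n m \<longleftrightarrow> (\<forall>p. m (m p) = p) \<and> (\<forall>p. m p \<noteq> p \<longleftrightarrow> p \<in> pts n)"

lemma matching_invol: "matching n m \<Longrightarrow> m (m p) = p"
  unfolding matching_def by blast

lemma matching_inj: "matching n m \<Longrightarrow> m p = m q \<longleftrightarrow> p = q"
  using matching_invol by metis

lemma matching_fixfree: "matching n m \<Longrightarrow> p \<in> pts n \<Longrightarrow> m p \<noteq> p"
  unfolding matching_def by blast

lemma matching_pts: "matching n m \<Longrightarrow> m p \<in> pts n \<longleftrightarrow> p \<in> pts n"
  unfolding matching_def by metis

section \<open>The Temperley--Lieb relations for caps\<close>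

abbreviation cap :: "nat \<Rightarrow> (pt \<Rightarrow> pt) \<Rightarrow> pt \<Rightarrow> pt" where
  "cap i \<equiv> reconnect (0, i) (0, Suc i)"

abbreviation makes_loop :: "nat \<Rightarrow> (pt \<Rightarrow> pt) \<Rightarrow> nat" where
  "makes_loop i m \<equiv> of_bool (m (0, i) = (0, Suc i))"

fun act :: "nat list \<Rightarrow> (pt \<Rightarrow> pt) \<Rightarrow> pt \<Rightarrow> pt" where
  "act [] m = m"
| "act (i # u) m = cap i (act u m)"

fun loops :: "nat list \<Rightarrow> (pt \<Rightarrow> pt) \<Rightarrow> nat" where
  "loops [] m = 0"
| "loops (i # u) m = loops u m + makes_loop i (act u m)"

lemma act_append: "act (u @ v) m = act u (act v m)"
  by (induction u) auto

lemma loops_append: "loops (u @ v) m = loops u (act v m) + loops v m"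
  by (induction u) (auto simp: act_append)

lemma cap_pts: "i \<in> {1..<n} \<Longrightarrow> (0, i) \<in> pts n" "i \<in> {1..<n} \<Longrightarrow> (0, Suc i) \<in> pts n"
  by (auto simp: pts_def)

lemma matching_reconnect:
  assumes "matching n m" "a \<in> pts n" "b \<in> pts n" "a \<noteq> b"
  shows "matching n (reconnect a b m)"
  using reconnect_involution[of m a b] assms matching_fixfree[OF assms(1)]
  unfolding matching_def by metis

lemma matching_act: "matching n m \<Longrightarrow> u \<in> lists {1..<n} \<Longrightarrow> matching n (act u m)"
  by (induction u) (auto intro!: matching_reconnect cap_pts)

text \<open>The second conclusion says that a repeated cap closes a loop, which is the factor
  \<open>zf\<close> in the relation for the square of a generator.\<close>

lemma cap_cap:
  assumes m: "matching n m" and i: "i \<in> {1..<n}"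
  shows "cap i (cap i m) = cap i m" "cap i m (0, i) = (0, Suc i)"
proof -
  note fp = matching_fixfree[OF m cap_pts(1)[OF i]] matching_fixfree[OF m cap_pts(2)[OF i]]
  have *: "cap i m (0, i) = (0, Suc i)" "cap i m (0, Suc i) = (0, i)"
    using fp matching_inj[OF m, of "(0, i)" "(0, Suc i)"] matching_invol[OF m]
    by (auto simp: reconnect_apply)
  then show "cap i (cap i m) = cap i m" "cap i m (0, i) = (0, Suc i)"
    by (auto simp: reconnect_def[of _ _ "cap i m"] fun_eq_iff)
qed

lemma cap_commute:
  assumes m: "matching n m" and ij: "i \<in> {1..<n}" "j \<in> {1..<n}" "\<bar>int i - int j\<bar> \<ge> 2"
  shows "cap i (cap j m) = cap j (cap i m)"
    and "makes_loop j m + makes_loop i (cap j m) = makes_loop i m + makes_loop j (cap i m)"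
proof -
  have "(0::nat, i) \<noteq> (0, Suc i)" "(0::nat, i) \<noteq> (0, j)" "(0::nat, i) \<noteq> (0, Suc j)"
    "(0::nat, Suc i) \<noteq> (0, j)" "(0::nat, Suc i) \<noteq> (0, Suc j)" "(0::nat, j) \<noteq> (0, Suc j)"
    using ij by auto
  note * = reconnect_commute[OF matching_invol[OF m] this
      cap_pts[OF ij(1), THEN matching_fixfree[OF m]] cap_pts[OF ij(2), THEN matching_fixfree[OF m]]]
  show "cap i (cap j m) = cap j (cap i m)"
    by (rule *(1))
  show "makes_loop j m + makes_loop i (cap j m) = makes_loop i m + makes_loop j (cap i m)"
    by (rule *(2))
qed

lemma cap_braid:
  assumes m: "matching n m" and ij: "i \<in> {1..<n}" "j \<in> {1..<n}" "\<bar>int i - int j\<bar> = 1"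
  shows "cap i (cap j (cap i m)) = cap i m"
    and "cap i m (0, j) \<noteq> (0, Suc j)" "cap j (cap i m) (0, i) \<noteq> (0, Suc i)"
proof -
  \<comment> \<open>\<open>c\<close> is the end of the cap \<open>j\<close> that is not shared with
    the cap \<open>i\<close>; it lies to the right of both \<open>a\<close> and \<open>b\<close> or
    to the left of both.\<close>
  define a b c where abc: "a = (0::nat, i)" "b = (0::nat, Suc i)" "c = (0::nat, if j = Suc i then Suc j else j)"
  have dist: "a \<noteq> b" "a \<noteq> c" "b \<noteq> c"
    using ij by (auto simp: abc)
  have pts: "a \<in> pts n" "b \<in> pts n" "c \<in> pts n"
    using ij by (auto simp: abc pts_def)
  note inv = matching_invol[OF m] and fp = pts[THEN matching_fixfree[OF m]]
  consider "j = Suc i" | "i = Suc j"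
    using ij(3) by linarith
  then have "cap i (cap j (cap i m)) = cap i m \<and>
      cap i m (0, j) \<noteq> (0, Suc j) \<and> cap j (cap i m) (0, i) \<noteq> (0, Suc i)"
  proof cases
    case 1
    then show ?thesis
      using reconnect_braid[OF inv dist fp] by (simp add: abc)
  next
    \<comment> \<open>Here the shared end is \<open>a\<close>, so \<open>reconnect_braid\<close> is
      applied with \<open>a\<close> and \<open>b\<close> exchanged, and symmetry restores the order
      of arguments used by \<open>cap\<close>.\<close>
    case 2
    have 3: "reconnect b a m = reconnect a b m"
      using dist matching_inj[OF m] by (intro reconnect_sym) auto
    have m': "matching n (reconnect a b m)"
      by (rule matching_reconnect) (use m dist pts in auto)
    have 4: "reconnect c a (reconnect a b m) = reconnect a c (reconnect a b m)"
      using dist matching_inj[OF m'] by (intro reconnect_sym) auto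
    have m'': "matching n (reconnect a c (reconnect a b m))"
      by (rule matching_reconnect) (use m' dist pts in auto)
    have 5: "reconnect b a (reconnect a c (reconnect a b m)) = reconnect a b (reconnect a c (reconnect a b m))"
      using dist matching_inj[OF m''] by (intro reconnect_sym) auto
    have "reconnect a b (reconnect c a (reconnect a b m)) = reconnect a b m"
      "reconnect a b m a \<noteq> c" "reconnect c a (reconnect a b m) b \<noteq> a"
      using reconnect_braid[of m b a c] inv dist fp by (auto simp: 3 4 5)
    moreover have "reconnect a b m c \<noteq> a" "reconnect c a (reconnect a b m) a \<noteq> b"
      using calculation(2,3) matching_invol[OF m'] matching_invol[OF m''] 4 by metis+
    ultimately show ?thesis
      using 2 by (simp add: abc)
  qed
  then show "cap i (cap j (cap i m)) = cap i m"
    "cap i m (0, j) \<noteq> (0, Suc j)" "cap j (cap i m) (0, i) \<noteq> (0, Suc i)"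
    by blast+
qed

section \<open>The linear action and its kernel\<close>

lemma lookup_scale: "Poly_Mapping.lookup (scale c x) k = c * Poly_Mapping.lookup x k"
  by (simp add: scale_def Poly_Mapping.map.rep_eq when_def)

lemma additive_scale_left: "additive (\<lambda>c. scale c x)"
  by (simp add: additive_def poly_mapping_eq_iff fun_eq_iff lookup_scale lookup_add algebra_simps)

lemma additive_scale_right: "additive (scale c)"
  by (simp add: additive_def poly_mapping_eq_iff fun_eq_iff lookup_scale lookup_add algebra_simps)

definition word_action :: "(nat list \<Rightarrow>\<^sub>0 Rf) \<Rightarrow> (pt \<Rightarrow> pt) \<Rightarrow> ((pt \<Rightarrow> pt) \<Rightarrow>\<^sub>0 Rf)" where
  "word_action p m = linext (\<lambda>u c. Poly_Mapping.single (act u m) (c * zf ^ loops u m)) p"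

lemma additive_word_action: "additive (\<lambda>p. word_action p m)"
  unfolding word_action_def by (intro additive_linext additive_single_mult_right)

lemma word_action_single:
  "word_action (Poly_Mapping.single u c) m = Poly_Mapping.single (act u m) (c * zf ^ loops u m)"
  unfolding word_action_def by (simp add: linext_single additive_single_mult_right)

text \<open>The law of a left module. On words it says that \<open>act\<close> composes and
  \<open>loops\<close> adds up under concatenation; additivity in each factor does the rest.\<close>

lemma word_action_mult:
  "word_action (word_mult p q) m = linext (\<lambda>m' d. scale d (word_action p m')) (word_action q m)"
proof -
  let ?s = "Poly_Mapping.single"
  note A = additive_word_action and S = additive_scale_left
  have lin: "additive (linext (\<lambda>m' d. scale d (word_action p m')))" for p
    by (intro additive_linext S)
  have lin': "additive (\<lambda>p. linext (\<lambda>m' d. scale d (word_action p m')) y)" for y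
    by (intro additive_linext_param additive_compose[OF additive_scale_right A])
  have 1: "word_action (word_mult (?s u c) (?s v d)) m
      = linext (\<lambda>m' d. scale d (word_action (?s u c) m')) (word_action (?s v d) m)" for u c v d
    by (simp add: word_mult_single word_action_single act_append loops_append linext_single S additive_single_mult_right
        scale_single power_add mult_ac)
  have 2: "word_action (word_mult (?s u c) q) m
      = linext (\<lambda>m' d. scale d (word_action (?s u c) m')) (word_action q m)" for u c
    by (rule additive_eqI'[OF additive_compose[OF A additive_word_mult_right]
          additive_compose[OF lin A]]) (rule 1)
  show ?thesis
    by (rule additive_eqI'[OF additive_compose[OF A additive_word_mult_left] lin']) (rule 2)
qed

lemma keys_word_action:
  assumes "matching n m" "Poly_Mapping.keys p \<subseteq> lists {1..<n}"
  shows "Poly_Mapping.keys (word_action p m) \<subseteq> Collect (matching n)"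
proof -
  have "matching n (act u m)" if "u \<in> Poly_Mapping.keys p" for u
    using matching_act[OF assms(1)] assms(2) that by blast
  then show ?thesis
    unfolding word_action_def linext_def by (intro keys_sum_subset) (auto split: if_splits)
qed

text \<open>Vanishing is required at every matching: the annihilator of a single one would in
  general be only a left ideal.\<close>

definition action_kernel :: "nat \<Rightarrow> (nat list \<Rightarrow>\<^sub>0 Rf) set" where
  "action_kernel n =
    {p. Poly_Mapping.keys p \<subseteq> lists {1..<n} \<and> (\<forall>m. matching n m \<longrightarrow> word_action p m = 0)}"

lemma ideal_action_kernel: "ideal (action_kernel n) (free_algebra n)"
proof (rule idealI[OF ring_free_algebra])
  interpret ring "free_algebra n"
    by (rule ring_free_algebra)
  note A = additive_word_action
  have minus: "\<ominus>\<^bsub>free_algebra n\<^esub> p = - p" if "Poly_Mapping.keys p \<subseteq> lists {1..<n}" for p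
    using that by (intro minus_equality) auto
  show "subgroup (action_kernel n) (add_monoid (free_algebra n))"
  proof
    fix p assume "p \<in> action_kernel n"
    then show "inv\<^bsub>add_monoid (free_algebra n)\<^esub> p \<in> action_kernel n"
      unfolding a_inv_def[symmetric] action_kernel_def by (simp add: minus additive.minus[OF A])
  qed (simp_all add: action_kernel_def additive.add[OF A] additive.zero[OF A] keys_add_subset
      Collect_mono_iff)
next
  fix p q assume p: "p \<in> action_kernel n" and q: "q \<in> carrier (free_algebra n)"
  have *: "linext (\<lambda>m' d. scale d (word_action q m')) 0 = 0"
    by (simp add: linext_def)
  show "q \<otimes>\<^bsub>free_algebra n\<^esub> p \<in> action_kernel n"
    using p q by (simp add: action_kernel_def word_action_mult * keys_word_mult)
  \<comment> \<open>Closure under right multiplication: \<open>q\<close> moves \<open>m\<close> to a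
    combination of matchings, and \<open>p\<close> annihilates each of them.\<close>
  have "linext (\<lambda>m' d. scale d (word_action p m')) (word_action q m) = 0" if "matching n m" for m
    unfolding linext_def using p keys_word_action[OF that, of q] q
    by (intro sum.neutral) (auto simp: action_kernel_def additive.zero[OF additive_scale_right])
  then show "p \<otimes>\<^bsub>free_algebra n\<^esub> q \<in> action_kernel n"
    using p q by (simp add: action_kernel_def word_action_mult keys_word_mult)
qed

lemma keys_diff_subset:
  "Poly_Mapping.keys x \<subseteq> K \<Longrightarrow> Poly_Mapping.keys y \<subseteq> K \<Longrightarrow> Poly_Mapping.keys (x - y) \<subseteq> K"
  using Poly_Mapping.keys_diff[of x y] by blast

lemma TL_relators_subset_kernel: "TL_relators n \<subseteq> action_kernel n"
proof -
  have rel: "Poly_Mapping.single u c - Poly_Mapping.single v d \<in> action_kernel n"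
    if "u \<in> lists {1..<n}" "v \<in> lists {1..<n}"
      "\<And>m. matching n m \<Longrightarrow> act u m = act v m \<and> c * zf ^ loops u m = d * zf ^ loops v m" for u c v d
    using that
    by (simp add: action_kernel_def additive.diff[OF additive_word_action] word_action_single
        keys_diff_subset)
  show ?thesis
    unfolding TL_relators_def
    by (intro Un_least subsetI; clarify; intro rel conjI)
      (simp_all add: cap_cap cap_commute cap_braid add.commute)
qed

text \<open>Representatives differ by an element of the generated ideal, which by minimality lies in
  the kernel of the action. This is what gives \<open>the_elem\<close> in \<open>TL_hom\<close> a
  meaning.\<close>

lemma TL_coset:
  assumes "x \<in> carrier (TL n)"
  obtains p where "p \<in> x" "Poly_Mapping.keys p \<subseteq> lists {1..<n}"
    "\<And>q. q \<in> x \<Longrightarrow> Poly_Mapping.keys q \<subseteq> lists {1..<n} \<and>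
      (\<forall>m. matching n m \<longrightarrow> word_action q m = word_action p m)"
proof -
  interpret ring "free_algebra n"
    by (rule ring_free_algebra)
  let ?I = "genideal (free_algebra n) (TL_relators n)"
  have I: "?I \<subseteq> action_kernel n"
    by (intro genideal_minimal ideal_action_kernel TL_relators_subset_kernel)
  have "TL_relators n \<subseteq> carrier (free_algebra n)"
    using TL_relators_subset_kernel by (auto simp: action_kernel_def)
  then interpret ideal ?I "free_algebra n"
    by (rule genideal_ideal)
  obtain p where p: "p \<in> carrier (free_algebra n)" and x: "x = ?I +>\<^bsub>free_algebra n\<^esub> p"
    using assms by (auto simp: TL_def FactRing_def A_RCOSETS_def')
  show thesis
  proof
    show "p \<in> x" "Poly_Mapping.keys p \<subseteq> lists {1..<n}"
      using a_rcos_self[OF p] p x by auto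
    fix q assume "q \<in> x"
    then obtain h where "h \<in> ?I" "q = h + p"
      unfolding x a_r_coset_def' by auto
    with I p show "Poly_Mapping.keys q \<subseteq> lists {1..<n} \<and>
        (\<forall>m. matching n m \<longrightarrow> word_action q m = word_action p m)"
      using keys_add_subset[of h "lists {1..<n}" p]
      by (auto simp: action_kernel_def additive.add[OF additive_word_action])
  qed
qed

section \<open>Tangles of matchings\<close>

definition tangle_of :: "nat \<Rightarrow> (pt \<Rightarrow> pt) \<Rightarrow> tangle" where
  "tangle_of n m = (\<lambda>p. {p, m p}) ` pts n"

lemma doubleton_in_tangle_of:
  "matching n m \<Longrightarrow> {p, q} \<in> tangle_of n m \<longleftrightarrow> p \<in> pts n \<and> q = m p"
  unfolding tangle_of_def using matching_invol matching_pts
  by (auto simp: doubleton_eq_iff image_iff) metis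

text \<open>It plays two parts: it is the matching of the identity tangle, and it describes the
  additional arcs of a closure.\<close>

definition flip :: "nat \<Rightarrow> pt \<Rightarrow> pt" where
  "flip n p = (if p \<in> pts n then (1 - fst p, snd p) else p)"

lemma matching_flip: "matching n (flip n)"
  by (auto simp: matching_def flip_def pts_def)

lemma pts_cases:
  assumes "p \<in> pts n"
  obtains (zero) k where "p = (0, k)" "k \<in> {1..n}" | (one) k where "p = (Suc 0, k)" "k \<in> {1..n}"
  using assms by (cases p) (auto simp: pts_def)

lemma id_tangle_eq: "id_tangle n = tangle_of n (flip n)"
proof (intro equalityI subsetI)
  fix \<alpha> assume "\<alpha> \<in> id_tangle n"
  then show "\<alpha> \<in> tangle_of n (flip n)"
    by (auto simp: id_tangle_def doubleton_in_tangle_of[OF matching_flip] flip_def pts_def)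
next
  fix \<alpha> assume "\<alpha> \<in> tangle_of n (flip n)"
  then obtain p where p: "p \<in> pts n" "\<alpha> = {p, flip n p}"
    unfolding tangle_of_def by blast
  from p(1) show "\<alpha> \<in> id_tangle n"
    by (cases rule: pts_cases) (auto simp: p(2) flip_def pts_def id_tangle_def insert_commute)
qed

lemma cap_flip_apply:
  assumes "i \<in> {1..<n}" "k \<in> {1..n}"
  shows "cap i (flip n) (0, k) = (if k = i then (0, Suc i) else if k = Suc i then (0, i) else (1, k))"
    and "cap i (flip n) (Suc 0, k) = (if k = i then (1, Suc i) else if k = Suc i then (1, i) else (0, k))"
  using assms by (auto simp: reconnect_apply flip_def pts_def)

lemma matching_cap: "matching n m \<Longrightarrow> i \<in> {1..<n} \<Longrightarrow> matching n (cap i m)"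
  by (rule matching_reconnect) (auto simp: pts_def)

text \<open>A generator is itself obtained by letting it act on the identity: the loose ends that
  get joined are \<open>(1, i)\<close> and \<open>(1, i + 1)\<close>. All facts about matchings thus
  apply to both factors of a product.\<close>

lemma gen_tangle_eq:
  assumes i: "i \<in> {1..<n}"
  shows "gen_tangle n i = tangle_of n (cap i (flip n))"
proof (intro equalityI subsetI)
  fix \<alpha> assume "\<alpha> \<in> gen_tangle n i"
  moreover have "{(0, i), (0, i + 1)} \<in> tangle_of n (cap i (flip n))"
    "{(1, i), (1, i + 1)} \<in> tangle_of n (cap i (flip n))"
    "\<And>k. k \<in> {1..n} \<Longrightarrow> k \<noteq> i \<Longrightarrow> k \<noteq> i + 1 \<Longrightarrow> {(0, k), (1, k)} \<in> tangle_of n (cap i (flip n))"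
    using i by (simp_all add: doubleton_in_tangle_of[OF matching_cap[OF matching_flip i]]
        cap_flip_apply pts_def)
  ultimately show "\<alpha> \<in> tangle_of n (cap i (flip n))"
    unfolding gen_tangle_def by blast
next
  fix \<alpha> assume "\<alpha> \<in> tangle_of n (cap i (flip n))"
  then obtain p where p: "p \<in> pts n" "\<alpha> = {p, cap i (flip n) p}"
    unfolding tangle_of_def by blast
  from p(1) show "\<alpha> \<in> gen_tangle n i"
    using i by (cases rule: pts_cases)
      (auto simp: p(2) cap_flip_apply gen_tangle_def insert_commute split: if_splits)
qed

section \<open>Canonical labels\<close>

text \<open>The horizontal displacement along \<open>\<alpha>\<close>, run from its smaller to its larger end, up to the sign
  \<open>-1\<close> if \<open>\<alpha>\<close> starts on the side \<open>1\<close>.  The double sum has only one nonzero summand.\<close>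

definition canonical_label :: "pt set \<Rightarrow> int" where
  "canonical_label \<alpha> =
    (\<Sum>p\<in>\<alpha>. \<Sum>q\<in>\<alpha>. if pt_less p q then (- 1) ^ fst p * (int (snd q) - int (snd p)) else 0)"

lemma pt_less_asym: "pt_less p q \<Longrightarrow> \<not> pt_less q p"
  by (cases p; cases q) (simp add: pt_less_def split: if_splits; linarith)

lemma pt_less_total: "p \<noteq> q \<Longrightarrow> \<not> pt_less p q \<Longrightarrow> pt_less q p"
  by (cases p; cases q) (simp add: pt_less_def split: if_splits; linarith)

lemma canonical_label_less:
  assumes "pt_less p q"
  shows "canonical_label {p, q} = (- 1) ^ fst p * (int (snd q) - int (snd p))"
proof -
  have "p \<noteq> q" "\<not> pt_less q p" "\<not> pt_less p p" "\<not> pt_less q q"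
    using assms pt_less_asym by metis+
  then show ?thesis
    using assms by (simp add: canonical_label_def)
qed

lemma parity_doubleton: "parity {p, q} = (if fst p = fst q then - 1 else 1)"
  unfolding parity_def by (cases p; cases q) (auto simp: doubleton_eq_iff)

text \<open>Running an arc backwards reverses its displacement. If both ends lie on one side, the
  extra parity factor of the cumulated parity compensates; if not, the arc starts on the side 1 and
  the sign of that side does.\<close>

lemma signed_label_step:
  assumes "p \<noteq> q" "fst p \<le> 1" "fst q \<le> 1"
  shows "(if pt_less p q then 1 else parity {p, q}) * canonical_label {p, q}
    = (- 1) ^ fst p * (int (snd q) - int (snd p))"
proof (cases "pt_less p q")
  case False
  then have *: "pt_less q p"
    using assms pt_less_total by metis
  then have "canonical_label {p, q} = (- 1) ^ fst q * (int (snd p) - int (snd q))"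
    using canonical_label_less[OF *] by (simp add: insert_commute)
  moreover have "fst p = fst q \<or> fst p = 1 \<and> fst q = 0"
    using * assms by (auto simp: pt_less_def)
  ultimately show ?thesis
    using False by (auto simp: parity_doubleton right_diff_distrib)
qed (simp add: canonical_label_less)

lemma label_sum_telescope:
  assumes w: "w \<noteq> []"
    and edge: "\<And>i. i < length w \<Longrightarrow> src w i \<noteq> tgt w i \<and> fst (src w i) \<le> 1 \<and> fst (tgt w i) \<le> 1 \<and>
      f (tag w i) (edge w i) = canonical_label (edge w i)"
    and step: "\<And>i. Suc i < length w \<Longrightarrow> snd (src w (Suc i)) = snd (tgt w i) \<and>
      fst (src w (Suc i)) = 1 - fst (tgt w i)"
  shows "label_sum f w =
    (- 1) ^ fst (src w 0) * (int (snd (tgt w (length w - 1))) - int (snd (src w 0)))"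
proof -
  \<comment> \<open>An arc of parity -1 stays on its side and the gluing then changes sides; an arc
    of parity 1 changes sides and the gluing changes back. In both cases the product keeps its
    value.\<close>
  have sign: "(\<Prod>j<i. parity (edge w j)) * (- 1) ^ fst (src w i) = (- 1) ^ fst (src w 0)"
    if "i < length w" for i
    using that
  proof (induction i)
    case (Suc i)
    have "fst (src w i) = 0 \<or> fst (src w i) = 1" "fst (tgt w i) = 0 \<or> fst (tgt w i) = 1"
      using edge[of i] Suc.prems by auto
    then have "parity (edge w i) * (- 1) ^ fst (src w (Suc i)) = (- 1) ^ fst (src w i)"
      using step[OF Suc.prems] by (auto simp: parity_doubleton)
    then show ?case
      using Suc by (simp add: mult.assoc)
  qed simp
  have summand: "cumulated_parity w i * f (tag w i) (edge w i)
      = (- 1) ^ fst (src w 0) * (int (snd (tgt w i)) - int (snd (src w i)))" if "i < length w" for i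
  proof -
    have "cumulated_parity w i
        = (\<Prod>j<i. parity (edge w j)) * (if pt_less (src w i) (tgt w i) then 1 else parity (edge w i))"
      by (simp add: cumulated_parity_def lessThan_Suc_atMost[symmetric])
    then show ?thesis
      using signed_label_step[of "src w i" "tgt w i"] edge[OF that] sign[OF that]
      by (simp add: mult.assoc)
  qed
  have "(\<Sum>i<Suc k. int (snd (tgt w i)) - int (snd (src w i)))
      = int (snd (tgt w k)) - int (snd (src w 0))" if "k < length w" for k
    using that by (induction k) (use step in auto)
  from this[of "length w - 1"] w
  have "(\<Sum>i<length w. int (snd (tgt w i)) - int (snd (src w i)))
      = int (snd (tgt w (length w - 1))) - int (snd (src w 0))"
    by simp
  then show ?thesis
    by (simp add: label_sum_def summand sum_distrib_left[symmetric])
qed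

definition lift :: "nat \<Rightarrow> (pt \<Rightarrow> pt) \<Rightarrow> arrow_tangle" where
  "lift n m = (tangle_of n m, restrict canonical_label (tangle_of n m))"

lemma id_arrow_tangle_eq: "id_arrow_tangle n = lift n (flip n)"
  by (auto simp: id_arrow_tangle_def lift_def id_tangle_eq[symmetric] id_tangle_def
      canonical_label_less pt_less_def intro!: restrict_ext)

lemma gen_arrow_tangle_eq:
  assumes i: "i \<in> {1..<n}"
  shows "gen_arrow_tangle n i = lift n (cap i (flip n))"
proof -
  have "canonical_label {(0, i), (0, i + 1)} = 1"
    by (simp add: canonical_label_less pt_less_def)
  \<comment> \<open>The order is reversed on the side 1, so the smaller end is
    \<open>(1, i + 1)\<close>: displacement -1 times sign -1.\<close>
  moreover have "canonical_label {(1, i), (1, i + 1)} = 1"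
    using canonical_label_less[of "(1, i + 1)" "(1, i)"]
    by (simp add: pt_less_def insert_commute)
  moreover have "canonical_label {(0, k), (1, k)} = 0" for k
    by (simp add: canonical_label_less pt_less_def)
  moreover have "{(0, k), (1, k)} \<notin> {{(0, i), (0, i + 1)}, {(1, i), (1, i + 1)}}" for k :: nat
    by (auto simp: doubleton_eq_iff)
  ultimately show ?thesis
    unfolding gen_arrow_tangle_def lift_def gen_tangle_eq[OF i, symmetric]
    by (intro arg_cong[of _ _ "Pair _"] restrict_ext) (auto simp: gen_tangle_def)
qed

section \<open>Gluing a generator\<close>

context
  fixes n i :: nat and m :: "pt \<Rightarrow> pt"
  assumes m: "matching n m" and i: "i \<in> {1..<n}"
begin

private abbreviation (input) "glued \<equiv> glue_adj n (gen_tangle n i) (tangle_of n m)"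

text \<open>The invariant \<open>strand\<close> separates the components of the glued complex; the points in \<open>inner\<close>
  are those on the turnback of \<open>E\<^sub>i\<close>, which forms a closed curve if \<open>m (0,i) = (0,i+1)\<close>.\<close>

private definition "inner = {(Lft, (Suc 0, i)), (Lft, (Suc 0, Suc i)), (Rgt, (0, i)), (Rgt, (0, Suc i))}"

text \<open>Outside \<open>inner\<close>, the boundary point whose free end is reached from
  \<open>x\<close> along a vertical strand of the generator, or \<open>x\<close> itself if it is
  free.\<close>

private definition outer :: "side \<times> pt \<Rightarrow> pt" where
  "outer x = (case x of (Lft, p) \<Rightarrow> (0, snd p) | (Rgt, p) \<Rightarrow> p)"

private definition strand :: "side \<times> pt \<Rightarrow> pt set" where
  "strand x = (if x \<in> inner then if m (0, i) = (0, Suc i) then {} else {m (0, i), m (0, Suc i)}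
     else {outer x, cap i m (outer x)})"

private lemma glue_adj_eq:
  "glued = {((Lft, p), (Lft, cap i (flip n) p)) | p. p \<in> pts n} \<union>
    {((Rgt, p), (Rgt, m p)) | p. p \<in> pts n} \<union>
    {((Lft, (Suc 0, k)), (Rgt, (0, k))) | k. k \<in> {1..n}} \<union>
    {((Rgt, (0, k)), (Lft, (Suc 0, k))) | k. k \<in> {1..n}}"
  unfolding glue_adj_def gen_tangle_eq[OF i]
    doubleton_in_tangle_of[OF m] doubleton_in_tangle_of[OF matching_cap[OF matching_flip i]] One_nat_def
  by blast

private lemma i_pts: "(0, i) \<in> pts n" "(0, Suc i) \<in> pts n" "(Suc 0, i) \<in> pts n" "(Suc 0, Suc i) \<in> pts n"
  using i by (auto simp: pts_def)

private lemma sym_glued: "sym glued"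
  unfolding glue_adj_def sym_def by (auto simp: insert_commute)

private lemma glued_sym: "(x, y) \<in> glued\<^sup>* \<Longrightarrow> (y, x) \<in> glued\<^sup>*"
  using sym_glued sym_rtrancl by (meson symD)

private lemma glued_right: "p \<in> pts n \<Longrightarrow> ((Rgt, p), (Rgt, m p)) \<in> glued\<^sup>*"
  and glued_left: "p \<in> pts n \<Longrightarrow> ((Lft, p), (Lft, cap i (flip n) p)) \<in> glued\<^sup>*"
  and glued_glue: "k \<in> {1..n} \<Longrightarrow> ((Rgt, (0, k)), (Lft, (Suc 0, k))) \<in> glued\<^sup>*"
  unfolding glue_adj_eq by (rule r_into_rtrancl, blast)+

private lemma m_neq: "m (0, i) \<noteq> (0, i)" "m (0, Suc i) \<noteq> (0, Suc i)" "m (0, i) \<noteq> m (0, Suc i)"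
  using matching_fixfree[OF m] i_pts matching_inj[OF m] by auto

lemma cap_eval:
  "cap i m (0, i) = (0, Suc i)" "cap i m (0, Suc i) = (0, i)"
  "m (0, i) \<noteq> (0, Suc i) \<Longrightarrow> cap i m (m (0, i)) = m (0, Suc i)"
  "m (0, i) \<noteq> (0, Suc i) \<Longrightarrow> cap i m (m (0, Suc i)) = m (0, i)"
  "p \<notin> {(0, i), (0, Suc i), m (0, i), m (0, Suc i)} \<Longrightarrow> cap i m p = m p"
proof -
  show 1: "cap i m (0, i) = (0, Suc i)"
    using m i by (rule cap_cap)
  show "cap i m (0, Suc i) = (0, i)"
    using matching_invol[OF matching_cap[OF m i], of "(0, i)"] by (simp add: 1)
qed (use m_neq in \<open>auto simp: reconnect_apply\<close>)

private lemma m_swap: "m p = (0, i) \<longleftrightarrow> p = m (0, i)" "m p = (0, Suc i) \<longleftrightarrow> p = m (0, Suc i)"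
  using matching_invol[OF m] by metis+

private lemma strand_right:
  assumes p: "p \<in> pts n"
  shows "strand (Rgt, p) = strand (Rgt, m p)"
proof -
  have swap: "m (0, Suc i) = (0, i) \<longleftrightarrow> m (0, i) = (0, Suc i)"
    using matching_invol[OF m] by metis
  have a: "strand (Rgt, (0, i)) = strand (Rgt, m (0, i))"
    using m_neq cap_eval(3) by (cases "m (0, i) = (0, Suc i)") (simp_all add: strand_def inner_def outer_def)
  have b: "strand (Rgt, (0, Suc i)) = strand (Rgt, m (0, Suc i))"
    using m_neq cap_eval(4) swap
    by (cases "m (0, i) = (0, Suc i)") (simp_all add: strand_def inner_def outer_def insert_commute)
  consider "p = (0, i)" | "p = (0, Suc i)" | "p = m (0, i)" | "p = m (0, Suc i)"
    | "p \<notin> {(0, i), (0, Suc i), m (0, i), m (0, Suc i)}" by auto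
  then show ?thesis
  proof cases
    case 5
    then have "m p \<notin> {(0, i), (0, Suc i), m (0, i), m (0, Suc i)}"
      using m_swap matching_inj[OF m] by auto
    with 5 show ?thesis
      using cap_eval(5)[of p] cap_eval(5)[of "m p"] matching_invol[OF m, of p]
      by (auto simp: strand_def inner_def outer_def)
  qed (simp_all add: a b matching_invol[OF m])
qed

private lemma strand_left:
  assumes p: "p \<in> pts n"
  shows "strand (Lft, p) = strand (Lft, cap i (flip n) p)"
  using p by (cases rule: pts_cases)
    (use i cap_eval(1,2) in \<open>auto simp: cap_flip_apply strand_def inner_def outer_def\<close>)

text \<open>This rules out connections: free ends belonging to different pairs lie in different
  components. The connections that do exist are constructed in
  \<open>free_ends_connected\<close>.\<close>

private lemma strand_invariant: "(x, y) \<in> glued\<^sup>* \<Longrightarrow> strand x = strand y"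
proof (induction rule: rtrancl_induct)
  case (step y z)
  have "strand (Lft, (Suc 0, k)) = strand (Rgt, (0, k))" for k
    by (auto simp: strand_def inner_def outer_def)
  with step.hyps(2) have "strand y = strand z"
    unfolding glue_adj_eq
    by (elim UnE CollectE exE conjE Pair_inject) (metis strand_left strand_right)+
  with step.IH show ?case
    by simp
qed simp

private lemma strand_free_end: "p \<in> pts n \<Longrightarrow> strand (free_end p) = {p, cap i m p}"
  by (cases rule: pts_cases) (auto simp: free_end_def strand_def inner_def outer_def)

private lemma to_free_end:
  assumes x: "x \<in> UNIV \<times> pts n" "x \<notin> inner"
  shows "(x, free_end (outer x)) \<in> glued\<^sup>* \<and> outer x \<in> pts n"
proof -
  obtain s p where Pair: "x = (s, p)"
    by (rule prod.exhaust)
  have L: "((Lft, (Suc 0, k)), (Lft, (0, k))) \<in> glued\<^sup>*" if "k \<in> {1..n}" "k \<noteq> i" "k \<noteq> Suc i" for k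
    using glued_left[of "(Suc 0, k)"] that i by (simp add: cap_flip_apply pts_def)
  from x Pair have "p \<in> pts n" by simp
  then show ?thesis
  proof (cases rule: pts_cases)
    case (zero k)
    show ?thesis
    proof (cases s)
      case Lft
      with zero Pair show ?thesis by (auto simp: outer_def free_end_def pts_def)
    next
      case Rgt
      with zero Pair x have "k \<noteq> i" "k \<noteq> Suc i"
        by (auto simp: inner_def)
      with zero Pair Rgt show ?thesis
        using rtrancl_trans[OF glued_glue L, of k] by (auto simp: outer_def free_end_def pts_def)
    qed
  next
    case (one k)
    show ?thesis
    proof (cases s)
      case Lft
      with one Pair x have "k \<noteq> i" "k \<noteq> Suc i"
        by (auto simp: inner_def)
      with one Pair Lft show ?thesis
        using L[of k] by (auto simp: outer_def free_end_def pts_def)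
    next
      case Rgt
      with one Pair show ?thesis by (auto simp: outer_def free_end_def pts_def)
    qed
  qed
qed

private lemma right_to_free_end:
  "p \<in> pts n \<Longrightarrow> p \<noteq> (0, i) \<Longrightarrow> p \<noteq> (0, Suc i) \<Longrightarrow> ((Rgt, p), free_end p) \<in> glued\<^sup>*"
  using to_free_end[of "(Rgt, p)"] by (auto simp: inner_def outer_def)

private lemma inner_connected: "((Rgt, (0, i)), (Rgt, (0, Suc i))) \<in> glued\<^sup>*"
proof -
  have "((Lft, (Suc 0, i)), (Lft, (Suc 0, Suc i))) \<in> glued\<^sup>*"
    using glued_left[OF i_pts(3)] i by (simp add: cap_flip_apply)
  then show ?thesis
    using glued_glue[of i] glued_glue[of "Suc i", THEN glued_sym] i by (auto intro: rtrancl_trans)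
qed

private lemma inner_class: "x \<in> inner \<Longrightarrow> ((Rgt, (0, i)), x) \<in> glued\<^sup>*"
  using glued_glue[of i] glued_glue[of "Suc i"] inner_connected i
  by (auto simp: inner_def intro: rtrancl_trans)

private lemma free_ends_connected:
  assumes p: "p \<in> pts n"
  shows "(free_end p, free_end (cap i m p)) \<in> glued\<^sup>*"
proof -
  have end_L: "((Lft, (0, i)), (Lft, (0, Suc i))) \<in> glued\<^sup>*"
    using glued_left[OF i_pts(1)] i by (simp add: cap_flip_apply)
  have free: "free_end (0, k) = (Lft, (0, k))" for k
    by (simp add: free_end_def)
  have ma: "m (0, i) \<in> pts n" "m (0, Suc i) \<in> pts n"
    using matching_pts[OF m] i_pts by auto
  \<comment> \<open>The loose ends are linked through the turnback: along an arc of the right factor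
    to \<open>(0, i)\<close>, across to \<open>(0, i + 1)\<close>, and along another arc out
    again.\<close>
  have join: "(free_end (m (0, i)), free_end (m (0, Suc i))) \<in> glued\<^sup>*" if "m (0, i) \<noteq> (0, Suc i)"
  proof -
    have ne: "m (0, Suc i) \<noteq> (0, i)"
      using that matching_invol[OF m] by metis
    have "(free_end (m (0, i)), (Rgt, m (0, i))) \<in> glued\<^sup>*"
      by (rule glued_sym[OF right_to_free_end]) (use ma m_neq that in auto)
    also have "((Rgt, m (0, i)), (Rgt, (0, i))) \<in> glued\<^sup>*"
      by (rule glued_sym[OF glued_right]) (rule i_pts)
    also note inner_connected
    also have "((Rgt, (0, Suc i)), (Rgt, m (0, Suc i))) \<in> glued\<^sup>*"
      by (rule glued_right) (rule i_pts)
    also have "((Rgt, m (0, Suc i)), free_end (m (0, Suc i))) \<in> glued\<^sup>*"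
      by (rule right_to_free_end) (use ma m_neq ne in auto)
    finally show ?thesis .
  qed
  consider "p = (0, i)" | "p = (0, Suc i)" | "p = m (0, i)" "m (0, i) \<noteq> (0, Suc i)"
    | "p = m (0, Suc i)" "m (0, i) \<noteq> (0, Suc i)"
    | "p \<notin> {(0, i), (0, Suc i), m (0, i), m (0, Suc i)}"
    using m_swap by (metis insertE singletonD)
  then show ?thesis
  proof cases
    case 5
    then have "m p \<noteq> (0, i)" "m p \<noteq> (0, Suc i)"
      using m_swap by auto
    then show ?thesis
      using right_to_free_end[of p, THEN glued_sym] glued_right[OF p] right_to_free_end[of "m p"] 5 p
        matching_pts[OF m] cap_eval(5)[of p]
      by (auto intro: rtrancl_trans)
  qed (use cap_eval end_L free join glued_sym in auto)
qed

lemma tangle_star_gen: "tangle_star n (gen_tangle n i) (tangle_of n m) = tangle_of n (cap i m)"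
proof -
  have "(free_end p, free_end q) \<in> glued\<^sup>* \<and> p \<noteq> q \<longleftrightarrow> q = cap i m p"
    if "p \<in> pts n" "q \<in> pts n" for p q
    using free_ends_connected[OF that(1)] strand_invariant[of "free_end p" "free_end q"]
      strand_free_end[OF that(1)] strand_free_end[OF that(2)]
      matching_fixfree[OF matching_cap[OF m i] that(1)] by (auto simp: doubleton_eq_iff)
  then show ?thesis
    unfolding tangle_star_def tangle_of_def using matching_pts[OF matching_cap[OF m i]] by blast
qed

text \<open>Points outside \<open>inner\<close> are connected to free ends and \<open>inner\<close>
  lies in one component, so at most one closed curve can arise, namely that of the turnback.\<close>

lemma glue_loops_gen: "glue_loops n (gen_tangle n i) (tangle_of n m) = makes_loop i m"
proof -
  let ?S = "{C \<in> (UNIV \<times> pts n) // glued\<^sup>*. C \<inter> free_end ` pts n = {}}"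
  have inner: "C = glued\<^sup>* `` {(Rgt, (0, i))}" if C: "C \<in> ?S" for C
  proof -
    obtain x where x: "x \<in> UNIV \<times> pts n" "C = glued\<^sup>* `` {x}"
      using C by (auto elim: quotientE)
    have "x \<in> inner"
      using to_free_end[of x] x C by auto
    then show ?thesis
      using x(2) inner_class[of x] glued_sym[OF inner_class[of x]] by (auto intro: rtrancl_trans)
  qed
  show ?thesis
  proof (cases "m (0, i) = (0, Suc i)")
    case True
    \<comment> \<open>At a free end the invariant is a nonempty pair, so the empty value keeps this
      component away from all of them.\<close>
    have "strand (Rgt, (0, i)) = {}"
      using True by (simp add: strand_def inner_def)
    then have "glued\<^sup>* `` {(Rgt, (0, i))} \<in> ?S"
      using strand_invariant[of "(Rgt, (0, i))"] strand_free_end i_pts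
      by (fastforce intro: quotientI)
    then have "?S = {glued\<^sup>* `` {(Rgt, (0, i))}}"
      using inner by blast
    then show ?thesis
      using True by (simp add: glue_loops_def)
  next
    case False
    have "((Rgt, (0, i)), free_end (m (0, i))) \<in> glued\<^sup>*"
      by (rule rtrancl_trans[OF glued_right right_to_free_end])
        (use False m_neq i_pts matching_pts[OF m] in auto)
    then have "glued\<^sup>* `` {(Rgt, (0, i))} \<notin> ?S"
      using matching_pts[OF m] i_pts by blast
    then have "?S = {}"
      using inner by blast
    then show ?thesis
      using False by (simp add: glue_loops_def del: Collect_empty_eq)
  qed
qed

end

section \<open>Arcs and cycles in products with a generator\<close>

lemma tangle_of_edge:
  assumes "matching n m" "{p, q} \<in> tangle_of n m"
  shows "p \<noteq> q" "fst p \<le> 1" "fst q \<le> 1" "p \<in> pts n" "q \<in> pts n"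
proof -
  have p: "p \<in> pts n" "q = m p"
    using doubleton_in_tangle_of[OF assms(1)] assms(2) by auto
  show "p \<noteq> q"
    using matching_fixfree[OF assms(1) p(1)] p(2) by metis
  show "p \<in> pts n" "q \<in> pts n"
    using p matching_pts[OF assms(1)] by auto
  then show "fst p \<le> 1" "fst q \<le> 1"
    by (auto simp: pts_def)
qed

text \<open>An arc is run from its smaller to its larger end, so the telescoped sum is literally the
  canonical label of the boundary. It therefore depends on the boundary alone.\<close>

lemma label_sum_arc:
  assumes m: "matching n m" "matching n m'"
    and w: "is_arc (tangle_of n m) (tangle_of n m') w"
  shows "label_sum (join_labels (restrict canonical_label (tangle_of n m))
      (restrict canonical_label (tangle_of n m'))) w = canonical_label (boundary w)"
proof -
  have E: "edge w j \<in> (case tag w j of Lft \<Rightarrow> tangle_of n m | Rgt \<Rightarrow> tangle_of n m')" if "j < length w" for j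
    using w that unfolding is_arc_def by blast
  have step: "snd (src w (Suc j)) = snd (tgt w j) \<and>
      (tag w j = Lft \<longrightarrow> fst (tgt w j) = 1 \<and> tag w (Suc j) = Rgt \<and> fst (src w (Suc j)) = 0) \<and>
      (tag w j = Rgt \<longrightarrow> fst (tgt w j) = 0 \<and> tag w (Suc j) = Lft \<and> fst (src w (Suc j)) = 1)"
    if "Suc j < length w" for j
    using w that unfolding is_arc_def by blast
  have less: "pt_less (src w 0) (tgt w (length w - 1))"
    using w unfolding is_arc_def by blast
  have "label_sum (join_labels (restrict canonical_label (tangle_of n m))
      (restrict canonical_label (tangle_of n m'))) w =
    (- 1) ^ fst (src w 0) * (int (snd (tgt w (length w - 1))) - int (snd (src w 0)))"
  proof (rule label_sum_telescope)
    show "w \<noteq> []"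
      using w unfolding is_arc_def by blast
  next
    fix j assume j: "j < length w"
    show "src w j \<noteq> tgt w j \<and> fst (src w j) \<le> 1 \<and> fst (tgt w j) \<le> 1 \<and>
      join_labels (restrict canonical_label (tangle_of n m))
        (restrict canonical_label (tangle_of n m')) (tag w j) (edge w j) = canonical_label (edge w j)"
      using E[OF j] tangle_of_edge[OF m(1), of "src w j" "tgt w j"]
        tangle_of_edge[OF m(2), of "src w j" "tgt w j"]
      by (cases "tag w j") (simp_all add: join_labels_def)
  next
    fix j assume "Suc j < length w"
    then show "snd (src w (Suc j)) = snd (tgt w j) \<and> fst (src w (Suc j)) = 1 - fst (tgt w j)"
      using step[of j] by (cases "tag w j") simp_all
  qed
  then show ?thesis
    unfolding boundary_def using canonical_label_less[OF less] by simp
qed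

text \<open>The total displacement is zero because a cycle ends in the column where it
  began.\<close>

lemma label_sum_cycle:
  assumes m: "matching n m" "matching n m'"
    and w: "is_cycle (tangle_of n m) (tangle_of n m') w"
  shows "label_sum (join_labels (restrict canonical_label (tangle_of n m))
      (restrict canonical_label (tangle_of n m'))) w = 0"
proof -
  have E: "if even j then tag w j = Lft \<and> edge w j \<in> tangle_of n m \<and> fst (src w j) = 1 \<and> fst (tgt w j) = 1
      else tag w j = Rgt \<and> edge w j \<in> tangle_of n m' \<and> fst (src w j) = 0 \<and> fst (tgt w j) = 0"
    if "j < length w" for j
    using w that unfolding is_cycle_def by blast
  have "label_sum (join_labels (restrict canonical_label (tangle_of n m))
      (restrict canonical_label (tangle_of n m'))) w =
    (- 1) ^ fst (src w 0) * (int (snd (tgt w (length w - 1))) - int (snd (src w 0)))"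
  proof (rule label_sum_telescope)
    show "w \<noteq> []"
      using w unfolding is_cycle_def by blast
  next
    fix j assume j: "j < length w"
    show "src w j \<noteq> tgt w j \<and> fst (src w j) \<le> 1 \<and> fst (tgt w j) \<le> 1 \<and>
      join_labels (restrict canonical_label (tangle_of n m))
        (restrict canonical_label (tangle_of n m')) (tag w j) (edge w j) = canonical_label (edge w j)"
      using E[OF j] tangle_of_edge[OF m(1), of "src w j" "tgt w j"]
        tangle_of_edge[OF m(2), of "src w j" "tgt w j"]
      by (cases "even j") (simp_all add: join_labels_def)
  next
    fix j assume j: "Suc j < length w"
    then have "snd (src w (Suc j)) = snd (tgt w j)"
      using w unfolding is_cycle_def by blast
    then show "snd (src w (Suc j)) = snd (tgt w j) \<and> fst (src w (Suc j)) = 1 - fst (tgt w j)"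
      using E[of j] E[of "Suc j"] j by (cases "even j") simp_all
  qed
  moreover have "snd (src w 0) = snd (tgt w (length w - 1))"
    using w unfolding is_cycle_def by blast
  ultimately show ?thesis
    by simp
qed

text \<open>Provides a witness for the description by \<open>THE\<close> in
  \<open>arrow_star\<close>; its value is then fixed by \<open>label_sum_arc\<close>.\<close>

lemma arc_exists:
  assumes m: "matching n m" and i: "i \<in> {1..<n}" and p: "p \<in> pts n" and less: "pt_less p (cap i m p)"
  shows "\<exists>w. is_arc (gen_tangle n i) (tangle_of n m) w \<and> boundary w = {p, cap i m p}"
proof -
  let ?a = "(0::nat, i)" and ?b = "(0::nat, Suc i)"
  note G = doubleton_in_tangle_of[OF matching_cap[OF matching_flip i], folded gen_tangle_eq[OF i]]
  note T = doubleton_in_tangle_of[OF m]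
  note arc = is_arc_def boundary_def All_less_Suc nth_Cons' G T cap_flip_apply
  \<comment> \<open>Arcs avoiding the turnback: each end on the side 0 costs one vertical strand of
    the generator, each end on the side 1 is already free.\<close>
  have through: "\<exists>w. is_arc (gen_tangle n i) (tangle_of n m) w \<and> boundary w = {p, q}"
    if p: "p \<in> pts n - {?a, ?b}" and q: "q \<in> pts n - {?a, ?b}" and "pt_less p q" "m p = q" for p q
  proof -
    have "p \<in> pts n" "q \<in> pts n"
      using p q by auto
    then show ?thesis
    proof (cases rule: pts_cases[case_product pts_cases])
      case (zero_zero k l)
      with that i show ?thesis
        by (intro exI[of _ "[(Lft, p, (1, k)), (Rgt, p, q), (Lft, (1, l), q)]"]) (simp add: arc pts_def)
    next
      case (zero_one k l)
      with that i show ?thesis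
        by (intro exI[of _ "[(Lft, p, (1, k)), (Rgt, p, q)]"]) (simp add: arc pts_def)
    next
      case (one_zero k l)
      with that i show ?thesis
        by (intro exI[of _ "[(Rgt, p, q), (Lft, (1, l), q)]"]) (simp add: arc pts_def)
    next
      case (one_one k l)
      with that i show ?thesis
        by (intro exI[of _ "[(Rgt, p, q)]"]) (simp add: arc pts_def)
    qed
  qed
  \<comment> \<open>Arcs entering the turnback in column \<open>j\<close> and leaving it in column
    \<open>j'\<close>. Both directions occur, since the smaller end may be attached to either
    column.\<close>
  have turn: "\<exists>w. is_arc (gen_tangle n i) (tangle_of n m) w \<and> boundary w = {p, q}"
    if p: "p \<in> pts n - {?a, ?b}" and q: "q \<in> pts n - {?a, ?b}" and "pt_less p q"
      and jj: "(j, j') \<in> {(i, Suc i), (Suc i, i)}" "m p = (0, j)" "m (0, j') = q" for p q j j'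
  proof -
    have jf: "j \<in> {1..n}" "j' \<in> {1..n}" "j \<noteq> j'" "cap i (flip n) (Suc 0, j) = (Suc 0, j')"
      using i jj(1) by (auto simp: cap_flip_apply)
    have "p \<in> pts n" "q \<in> pts n"
      using p q by auto
    then show ?thesis
    proof (cases rule: pts_cases[case_product pts_cases])
      case (zero_zero k l)
      with that i jf show ?thesis
        by (intro exI[of _ "[(Lft, p, (1, k)), (Rgt, p, (0, j)), (Lft, (1, j), (1, j')),
              (Rgt, (0, j'), q), (Lft, (1, l), q)]"])
         (simp add: arc pts_def)
    next
      case (zero_one k l)
      with that i jf show ?thesis
        by (intro exI[of _ "[(Lft, p, (1, k)), (Rgt, p, (0, j)), (Lft, (1, j), (1, j')), (Rgt, (0, j'), q)]"])
         (simp add: arc pts_def)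
    next
      case (one_zero k l)
      with that i jf show ?thesis
        by (intro exI[of _ "[(Rgt, p, (0, j)), (Lft, (1, j), (1, j')), (Rgt, (0, j'), q), (Lft, (1, l), q)]"])
         (simp add: arc pts_def)
    next
      case (one_one k l)
      with that i jf show ?thesis
        by (intro exI[of _ "[(Rgt, p, (0, j)), (Lft, (1, j), (1, j')), (Rgt, (0, j'), q)]"])
         (simp add: arc pts_def)
    qed
  qed
  have m_pts: "m (0, i) \<in> pts n" "m (0, Suc i) \<in> pts n"
    using matching_pts[OF m] cap_pts[OF i] by auto
  have ne: "m ?a \<noteq> ?a" "m ?b \<noteq> ?b"
    using matching_fixfree[OF m] cap_pts[OF i] by auto
  have swap: "m ?b = ?a \<longleftrightarrow> m ?a = ?b" "m (m q) = q" "m p = ?a \<longleftrightarrow> p = m ?a" "m p = ?b \<longleftrightarrow> p = m ?b" for q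
    using matching_invol[OF m] by metis+
  consider "p = ?a" | "p = ?b" | "p = m ?a" "m ?a \<noteq> ?b" | "p = m ?b" "m ?a \<noteq> ?b"
    | "p \<notin> {?a, ?b, m ?a, m ?b}"
    using swap by blast
  then show ?thesis
  proof cases
    case 1
    have "is_arc (gen_tangle n i) (tangle_of n m) [(Lft, ?a, ?b)] \<and> boundary [(Lft, ?a, ?b)] = {?a, ?b}"
      using i by (simp add: arc pts_def pt_less_def)
    with 1 show ?thesis
      using cap_eval(1)[OF m i] by auto
  next
    case 2
    with less show ?thesis
      using cap_eval(2)[OF m i] by (simp add: pt_less_def)
  next
    case 3
    with less show ?thesis
      using cap_eval(3)[OF m i 3(2)] m_pts ne swap
      by (intro turn[of _ _ i "Suc i"]) auto
  next
    case 4
    with less show ?thesis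
      using cap_eval(4)[OF m i 4(2)] m_pts ne swap
      by (intro turn[of _ _ "Suc i" i]) auto
  next
    case 5
    with less p show ?thesis
      using cap_eval(5)[OF m i 5] matching_pts[OF m, of p] swap
      by (intro through) auto
  qed
qed

lemma arrow_star_gen:
  assumes m: "matching n m" and i: "i \<in> {1..<n}"
  shows "arrow_star n (gen_arrow_tangle n i) (lift n m) = lift n (cap i m)"
proof -
  let ?E = "gen_tangle n i" and ?E' = "tangle_of n m"
  let ?f = "join_labels (restrict canonical_label ?E) (restrict canonical_label ?E')"
  have the: "(THE k. \<exists>w. is_arc ?E ?E' w \<and> boundary w = \<beta> \<and> k = label_sum ?f w) = canonical_label \<beta>"
    if "\<beta> \<in> tangle_of n (cap i m)" for \<beta>
  proof -
    obtain p where p: "p \<in> pts n" "\<beta> = {p, cap i m p}"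
      using \<open>\<beta> \<in> tangle_of n (cap i m)\<close> unfolding tangle_of_def by blast
    have c: "matching n (cap i m)"
      using m i by (rule matching_cap)
    \<comment> \<open>\<open>arc_exists\<close> starts from the smaller end, which may be either
      point of \<open>\<beta>\<close>.\<close>
    obtain q where q: "q \<in> pts n" "\<beta> = {q, cap i m q}" "pt_less q (cap i m q)"
    proof (cases "pt_less p (cap i m p)")
      case True
      then show ?thesis
        using p that by blast
    next
      case False
      then have "pt_less (cap i m p) p"
        using pt_less_total matching_fixfree[OF c p(1)] by metis
      then show ?thesis
        using that[of "cap i m p"] p matching_pts[OF c, of p] matching_invol[OF c, of p]
        by (simp add: insert_commute)
    qed
    have label: "label_sum ?f w = canonical_label \<beta>" if "is_arc ?E ?E' w" "boundary w = \<beta>" for w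
      using label_sum_arc[OF matching_cap[OF matching_flip i] m] that
      unfolding gen_tangle_eq[OF i] by blast
    show ?thesis
      using arc_exists[OF m i q(1,3)] unfolding q(2)[symmetric]
      by (intro the_equality) (use label in auto)
  qed
  show ?thesis
    unfolding arrow_star_def lift_def gen_arrow_tangle_eq[OF i] gen_tangle_eq[OF i, symmetric]
      prod.case tangle_star_gen[OF m i]
    by (intro arg_cong[of _ _ "Pair _"] restrict_ext the)
qed

lemma cycles_gen:
  assumes m: "matching n m" and i: "i \<in> {1..<n}"
  shows "{w. is_cycle (gen_tangle n i) (tangle_of n m) w} =
    (if m (0, i) = (0, Suc i) then {[(Lft, (1, i), (1, Suc i)), (Rgt, (0, Suc i), (0, i))]} else {})"
    (is "?C = ?D")
proof (intro equalityI subsetI)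
  note G = doubleton_in_tangle_of[OF matching_cap[OF matching_flip i], folded gen_tangle_eq[OF i]]
  note T = doubleton_in_tangle_of[OF m]
  have inv: "m (m p) = p" for p
    using matching_invol[OF m] .
  {
    fix w assume "w \<in> ?C"
    then have w: "is_cycle (gen_tangle n i) (tangle_of n m) w"
      by simp
    then have E: "if even j then tag w j = Lft \<and> edge w j \<in> gen_tangle n i \<and> fst (src w j) = 1 \<and> fst (tgt w j) = 1
        else tag w j = Rgt \<and> edge w j \<in> tangle_of n m \<and> fst (src w j) = 0 \<and> fst (tgt w j) = 0"
      if "j < length w" for j
      using that unfolding is_cycle_def by blast
    have step: "snd (src w (Suc j)) = snd (tgt w j) \<and> snd (src w 0) < snd (tgt w j)"
      if "Suc j < length w" for j
      using w that unfolding is_cycle_def by blast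
    have "length w \<noteq> 0" and even: "even (length w)"
      using w unfolding is_cycle_def by blast+
    then have len: "length w \<ge> 2"
      by presburger
    then have len': "0 < length w" "Suc 0 < length w" "1 < length w"
      by linarith+
    \<comment> \<open>The turnback is the only arc of the generator with both ends on the side 1, so
      it occupies every even position.\<close>
    have turn: "snd (src w j) = i \<and> snd (tgt w j) = Suc i \<or> snd (src w j) = Suc i \<and> snd (tgt w j) = i"
      if j: "j < length w" "even j" for j
    proof -
      obtain s where s: "src w j = (Suc 0, s)"
        using E[OF j(1)] j(2) by (cases "src w j") auto
      then have "s \<in> {1..n}" "tgt w j = cap i (flip n) (Suc 0, s)" "fst (tgt w j) = 1"
        using E[OF j(1)] j(2) by (auto simp: G pts_def)
      then show ?thesis
        using cap_flip_apply(2)[OF i] s by (auto split: if_splits)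
    qed
    have 0: "src w 0 = (1, i)" "tgt w 0 = (1, Suc i)" "tag w 0 = Lft"
      using turn[OF len'(1)] step[OF len'(2)] E[OF len'(1)] by (auto simp: prod_eq_iff)
    have src1: "src w 1 = (0, Suc i)"
      using 0 step[OF len'(2)] E[OF len'(3)] by (auto simp: prod_eq_iff)
    have 1: "tag w 1 = Rgt" "tgt w 1 = m (0, Suc i)" "fst (tgt w 1) = 0"
      using E[OF len'(3)] unfolding src1 T by auto
    \<comment> \<open>A third entry would again be the turnback. It cannot start in column
      \<open>i\<close>, as later columns exceed the first one, and starting in column
      \<open>i + 1\<close> would make \<open>(0, i + 1)\<close> a fixed point of
      \<open>m\<close>.\<close>
    have len2: "length w = 2"
    proof (rule ccontr)
      assume "length w \<noteq> 2"
      then have len3: "Suc 1 < length w"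
        using len by simp
      then have "snd (tgt w 1) = Suc i"
        using step[OF len3] turn[OF len3] 0 by auto
      then have "m (0, Suc i) = (0, Suc i)"
        using 1 by (simp add: prod_eq_iff)
      then show False
        using matching_fixfree[OF m cap_pts(2)[OF i]] by blast
    qed
    then have "snd (tgt w 1) = i"
      using w 0 unfolding is_cycle_def by simp
    then have t1: "tgt w 1 = (0, i)"
      using 1 by (simp add: prod_eq_iff)
    then have "m (0, i) = (0, Suc i)"
      using 1(2) inv[of "(0, Suc i)"] by simp
    moreover have "w = [(Lft, (1, i), (1, Suc i)), (Rgt, (0, Suc i), (0, i))]"
      using len2 0 src1 1(1) t1
      by (intro nth_equalityI) (auto simp: less_2_cases_iff prod_eq_iff)
    ultimately show "w \<in> ?D"
      by simp
  }
  {
    fix w assume "w \<in> ?D"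
    then have w: "m (0, i) = (0, Suc i)" "w = [(Lft, (1, i), (1, Suc i)), (Rgt, (0, Suc i), (0, i))]"
      by (auto split: if_splits)
    moreover have "m (0, Suc i) = (0, i)"
      using w(1) inv[of "(0, i)"] by simp
    ultimately show "w \<in> ?C"
      using i by (simp add: is_cycle_def All_less_Suc nth_Cons' G T cap_flip_apply pts_def)
  }
qed

lemma arrow_coeff_gen:
  assumes m: "matching n m" and i: "i \<in> {1..<n}"
  shows "arrow_coeff (gen_arrow_tangle n i) (lift n m) = za 0 ^ makes_loop i m"
proof -
  have "arrow_coeff (gen_arrow_tangle n i) (lift n m)
      = (\<Prod>w\<in>{w. is_cycle (gen_tangle n i) (tangle_of n m) w}. za 0)"
    unfolding arrow_coeff_def lift_def gen_arrow_tangle_eq[OF i] gen_tangle_eq[OF i] prod.case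
    by (intro prod.cong)
      (simp_all add: zeta_def label_sum_cycle[OF matching_cap[OF matching_flip i] m] del: za.simps)
  also have "\<dots> = za 0 ^ makes_loop i m"
    unfolding cycles_gen[OF m i] by (simp del: za.simps)
  finally show ?thesis .
qed

section \<open>Closures\<close>

context
  fixes n :: nat and m :: "pt \<Rightarrow> pt"
  assumes m: "matching n m"
begin

private abbreviation (input) "joined \<equiv> closure_adj n (tangle_of n m)"

text \<open>One step of a walk in the closure: along an arc of the tangle, then along a closing arc.
  The sources of a closure cycle are the iterates of its first source.\<close>

private definition advance :: "pt \<Rightarrow> pt" where
  "advance p = flip n (m p)"

private lemma closure_adj_eq: "joined = {(p, m p) | p. p \<in> pts n} \<union> {(p, flip n p) | p. p \<in> pts n}"
proof -
  have flip: "flip n (0, k) = (1, k)" "flip n (1, k) = (0, k)" "(0, k) \<in> pts n" "(1, k) \<in> pts n"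
    if "k \<in> {1..n}" for k
    using that by (simp_all add: flip_def pts_def)
  have "{(p, flip n p) | p. p \<in> pts n}
      = {((0, k), (1, k)) | k. k \<in> {1..n}} \<union> {((1, k), (0, k)) | k. k \<in> {1..n}}"
    (is "?L = ?joined")
  proof
    show "?L \<subseteq> ?joined"
    proof
      fix x assume "x \<in> ?L"
      then obtain p where p: "p \<in> pts n" "x = (p, flip n p)"
        by blast
      from p(1) show "x \<in> ?joined"
        by (cases rule: pts_cases) (use flip p(2) in auto)
    qed
    show "?joined \<subseteq> ?L"
      using flip by (safe; metis)
  qed
  then show ?thesis
    unfolding closure_adj_def doubleton_in_tangle_of[OF m] by blast
qed

private lemma joined_sym: "(x, y) \<in> joined\<^sup>* \<Longrightarrow> (y, x) \<in> joined\<^sup>*"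
proof -
  have "sym joined"
    unfolding closure_adj_def sym_def by (auto simp: insert_commute)
  then show "(x, y) \<in> joined\<^sup>* \<Longrightarrow> (y, x) \<in> joined\<^sup>*"
    using sym_rtrancl by (meson symD)
qed

private lemma flip_invol: "flip n (flip n p) = p"
  by (rule matching_invol[OF matching_flip])

private lemma advance_pts: "advance p \<in> pts n \<longleftrightarrow> p \<in> pts n"
  by (simp add: advance_def matching_pts[OF matching_flip] matching_pts[OF m])

private lemma advance_pow_pts: "(advance ^^ k) p \<in> pts n \<longleftrightarrow> p \<in> pts n"
  by (induction k) (simp_all add: advance_pts)

private lemma inj_advance_pow: "inj (advance ^^ k)"
  by (intro inj_fn injI) (metis advance_def flip_invol matching_invol[OF m])

text \<open>Conjugation by the flip inverts \<open>advance\<close>; as neither involution has a fixed point, the orbit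
  of a point therefore avoids its flip.\<close>

private lemma advance_flip_pow: "(advance ^^ k) (flip n ((advance ^^ k) p)) = flip n p"
proof (induction k)
  case (Suc k)
  have "advance (flip n (advance q)) = flip n q" for q
    by (simp add: advance_def flip_invol matching_invol[OF m])
  then show ?case
    using Suc by (simp add: funpow_swap1[of advance k "flip n _"])
qed simp

private lemma advance_pow_neq_flip:
  assumes p: "p \<in> pts n"
  shows "(advance ^^ k) p \<noteq> flip n p"
proof
  assume eq: "(advance ^^ k) p = flip n p"
  \<comment> \<open>Halving the way from \<open>p\<close> to its flip: the midpoint \<open>q\<close>
    would be fixed by the flip if \<open>k\<close> is even, and by \<open>m\<close> if
    \<open>k\<close> is odd.\<close>
  define j where "j = k div 2"
  define q where "q = (advance ^^ j) p"
  have q: "q \<in> pts n"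
    using p by (simp add: q_def advance_pow_pts)
  have flip_q: "(advance ^^ j) (flip n q) = flip n p"
    unfolding q_def by (rule advance_flip_pow)
  show False
  proof (cases "even k")
    case True
    then have "k = j + j"
      by (auto simp: j_def)
    then have "(advance ^^ j) q = (advance ^^ j) (flip n q)"
      using eq flip_q by (simp add: q_def funpow_add)
    then show False
      using injD[OF inj_advance_pow] matching_fixfree[OF matching_flip q] by metis
  next
    case False
    then have "k = j + Suc j"
      by (auto simp: j_def elim: oddE)
    then have "(advance ^^ j) (advance q) = (advance ^^ j) (flip n q)"
      using eq flip_q by (simp add: q_def funpow_add funpow_swap1)
    then have "flip n (m q) = flip n q"
      using injD[OF inj_advance_pow] by (metis advance_def)
    then show False
      using matching_inj[OF matching_flip] matching_fixfree[OF m q] by metis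
  qed
qed

private lemma finite_pts: "finite (pts n)"
  by (simp add: pts_def)

private lemma advance_period: "\<exists>k>0. (advance ^^ k) p = p"
proof -
  have "bij advance"
    by (rule o_bij[of "\<lambda>q. m (flip n q)"])
      (simp_all add: fun_eq_iff advance_def flip_invol matching_invol[OF m] del: split_paired_All)
  moreover have "advance q = q" if "q \<notin> pts n" for q
    using that m matching_flip unfolding advance_def matching_def by metis
  ultimately have "advance permutes pts n"
    unfolding permutes_def bij_iff by blast
  then show ?thesis
    using permutation_self permutes_imp_permutation[OF finite_pts] by metis
qed

section \<open>One normalised walk for each component of the closure\<close>

private definition orbit_walk :: "pt \<Rightarrow> nat \<Rightarrow> unit walk" where
  "orbit_walk p l = map (\<lambda>j. ((), (advance ^^ j) p, m ((advance ^^ j) p))) [0..<l]"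

text \<open>The strict inequality makes \<open>l\<close> the first return time and puts
  \<open>p\<close> alone in the least column visited by the orbit.\<close>

private definition cycle_start :: "pt \<Rightarrow> nat \<Rightarrow> bool" where
  "cycle_start p l \<longleftrightarrow> p \<in> pts n \<and> fst p = 0 \<and> l > 0 \<and> (advance ^^ l) p = p \<and>
    (\<forall>j. 0 < j \<and> j < l \<longrightarrow> snd p < snd ((advance ^^ j) p))"

private lemma flip_apply: "p \<in> pts n \<Longrightarrow> snd (flip n p) = snd p \<and> fst (flip n p) = 1 - fst p"
  by (simp add: flip_def)

private lemma cycle_start_of_walk:
  assumes w: "is_closure_cycle (tangle_of n m) w"
  shows "cycle_start (src w 0) (length w) \<and> w = orbit_walk (src w 0) (length w)"
proof -
  let ?p = "src w 0"
  have w0: "w \<noteq> []" and last: "snd (src w 0) = snd (tgt w (length w - 1))"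
    "fst (src w 0) = 0" "fst (tgt w (length w - 1)) = 1"
    using w unfolding is_closure_cycle_def by blast+
  have E: "src w j \<in> pts n" "tgt w j = m (src w j)" if "j < length w" for j
    using w that doubleton_in_tangle_of[OF m] unfolding is_closure_cycle_def by blast+
  have step: "snd (src w (Suc j)) = snd (tgt w j) \<and>
      (fst (tgt w j) = 0 \<longrightarrow> fst (src w (Suc j)) = 1) \<and>
      (fst (tgt w j) = 1 \<longrightarrow> fst (src w (Suc j)) = 0) \<and> snd (src w 0) < snd (tgt w j)"
    if "Suc j < length w" for j
    using w that unfolding is_closure_cycle_def by blast
  have tgt_pts: "tgt w j \<in> pts n" if "j < length w" for j
    using E[OF that] matching_pts[OF m] by metis
  have src: "src w j = (advance ^^ j) ?p" if "j < length w" for j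
    using that
  proof (induction j)
    case (Suc j)
    then have j: "j < length w" by simp
    have "fst (tgt w j) = 0 \<or> fst (tgt w j) = 1"
      using tgt_pts[OF j] by (auto simp: pts_def)
    then have "src w (Suc j) = flip n (tgt w j)"
      using step[OF Suc.prems] flip_apply[OF tgt_pts[OF j]] by (auto simp: prod_eq_iff)
    then show ?case
      using Suc E(2)[OF j] by (simp add: advance_def)
  qed simp
  have "w ! j = orbit_walk ?p (length w) ! j" if "j < length w" for j
    using that src[OF that] E(2)[OF that] by (cases "w ! j") (simp add: orbit_walk_def)
  then have "w = orbit_walk ?p (length w)"
    by (intro nth_equalityI) (auto simp: orbit_walk_def)
  moreover have "(advance ^^ length w) ?p = ?p"
  proof -
    obtain l where l: "length w = Suc l"
      using w0 by (cases w) auto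
    have "(advance ^^ length w) ?p = flip n (tgt w l)"
      using src[of l] E(2)[of l] l by (simp add: advance_def)
    also have "\<dots> = ?p"
      using flip_apply[OF tgt_pts[of l]] last l by (auto simp: prod_eq_iff)
    finally show ?thesis .
  qed
  \<comment> \<open>Closure cycles bound the columns of targets; target \<open>j - 1\<close> and
    source \<open>j\<close> lie in the same column.\<close>
  moreover have "snd ?p < snd ((advance ^^ j) ?p)" if j: "0 < j" "j < length w" for j
  proof -
    have "snd (src w j) = snd (tgt w (j - 1)) \<and> snd ?p < snd (tgt w (j - 1))"
      using step[of "j - 1"] j by simp
    then show ?thesis
      using src[OF j(2)] by simp
  qed
  ultimately show ?thesis
    unfolding cycle_start_def using E(1)[of 0] w0 last by auto
qed

private lemma walk_of_cycle_start:
  assumes g: "cycle_start p l"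
  shows "is_closure_cycle (tangle_of n m) (orbit_walk p l)"
proof -
  have pts: "(advance ^^ j) p \<in> pts n" "m ((advance ^^ j) p) \<in> pts n" for j
    using g by (simp_all add: cycle_start_def advance_pow_pts matching_pts[OF m])
  have *: "snd (m ((advance ^^ j) p)) = snd ((advance ^^ Suc j) p)"
    "fst ((advance ^^ Suc j) p) = 1 - fst (m ((advance ^^ j) p))" for j
    using flip_apply[OF pts(2)[of j]] by (simp_all add: advance_def)
  have fst01: "fst q = 0 \<or> fst q = 1" if "q \<in> pts n" for q
    using that by (auto simp: pts_def)
  obtain l' where l': "l = Suc l'"
    using g by (cases l) (auto simp: cycle_start_def)
  have last: "snd (m ((advance ^^ l') p)) = snd p" "fst (m ((advance ^^ l') p)) = 1"
    using *[of l'] g l' fst01[OF pts(2)[of l']] by (auto simp: cycle_start_def)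
  show ?thesis
    unfolding is_closure_cycle_def
    using g last pts * l' by (auto simp: orbit_walk_def cycle_start_def doubleton_in_tangle_of[OF m] simp del: upt_Suc)
qed

private lemma snd_component:
  assumes g: "cycle_start p l" and q: "(p, q) \<in> joined\<^sup>*"
  shows "snd p \<le> snd q"
proof -
  have p: "p \<in> pts n"
    using g by (simp add: cycle_start_def)
  have pullback: "m (flip n (advance q)) = q" for q
    by (simp add: advance_def flip_invol matching_invol[OF m])
  \<comment> \<open>The orbit is closed under going backwards too: before \<open>p\<close> comes the
    iterate number \<open>l - 1\<close>.\<close>
  have predecessor: "\<exists>j'. (advance ^^ j) p = advance ((advance ^^ j') p)" for j
  proof (cases j)
    case 0
    obtain l' where "l = Suc l'"
      using g by (cases l) (auto simp: cycle_start_def)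
    then show ?thesis
      using 0 g by (auto simp: cycle_start_def intro!: exI[of _ l'])
  qed auto
  \<comment> \<open>The component consists of the orbit and its flip. The flip exchanges these
    halves, and so does \<open>m\<close>, shifting the iterate by one step. Since the flip preserves
    columns, the orbit alone decides which columns occur.\<close>
  have "\<exists>j. q = (advance ^^ j) p \<or> q = flip n ((advance ^^ j) p)"
    using q
  proof (induction rule: rtrancl_induct)
    case base
    show ?case
      by (rule exI[of _ 0]) simp
  next
    case (step y z)
    from step.IH obtain j where "y = (advance ^^ j) p \<or> y = flip n ((advance ^^ j) p)" ..
    moreover obtain j' where "(advance ^^ j) p = advance ((advance ^^ j') p)"
      using predecessor by blast
    moreover have "m ((advance ^^ j) p) = flip n ((advance ^^ Suc j) p)"
      by (simp add: advance_def flip_invol)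
    moreover have "z = m y \<or> z = flip n y"
      using step.hyps(2) unfolding closure_adj_eq by blast
    ultimately show ?case
      using pullback flip_invol by metis
  qed
  then obtain j where "q = (advance ^^ j) p \<or> q = flip n ((advance ^^ j) p)" ..
  then have "snd q = snd ((advance ^^ j) p)"
    using flip_apply advance_pow_pts p by metis
  also have "\<dots> = snd ((advance ^^ (j mod l)) p)"
    using g by (simp add: cycle_start_def funpow_mod_eq)
  also have "snd p \<le> \<dots>"
    using g by (cases "j mod l = 0") (auto simp: cycle_start_def intro!: less_imp_le)
  finally show ?thesis .
qed

private lemma cycle_start_unique:
  assumes "cycle_start p l" "cycle_start p' l'" "(p, p') \<in> joined\<^sup>*"
  shows "p = p' \<and> l = l'"
proof -
  have "snd p = snd p'"
    using snd_component[OF assms(1,3)] snd_component[OF assms(2) joined_sym[OF assms(3)]] by simp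
  then have "p = p'"
    using assms by (auto simp: cycle_start_def prod_eq_iff)
  moreover have "\<not> l < l'" "\<not> l' < l"
    using assms \<open>p = p'\<close> by (auto simp: cycle_start_def)
  ultimately show ?thesis
    by simp
qed

private lemma component_pts: "(p, q) \<in> joined\<^sup>* \<Longrightarrow> p \<in> pts n \<Longrightarrow> q \<in> pts n"
proof (induction rule: rtrancl_induct)
  case (step y z)
  then show ?case
    unfolding closure_adj_eq using matching_pts[OF m] matching_pts[OF matching_flip] by auto
qed

private lemma advance_component: "p \<in> pts n \<Longrightarrow> (p, (advance ^^ j) p) \<in> joined\<^sup>*"
proof (induction j)
  case (Suc j)
  define q where "q = (advance ^^ j) p"
  have "q \<in> pts n" "m q \<in> pts n"
    using Suc.prems by (simp_all add: q_def advance_pow_pts matching_pts[OF m])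
  then have "(q, m q) \<in> joined" "(m q, flip n (m q)) \<in> joined"
    unfolding closure_adj_eq by blast+
  moreover have "(p, q) \<in> joined\<^sup>*"
    using Suc by (simp add: q_def)
  ultimately have "(p, advance q) \<in> joined\<^sup>*"
    unfolding advance_def[of q] by (meson rtrancl.rtrancl_into_rtrancl)
  then show ?case
    by (simp add: q_def)
qed simp

private lemma cycle_start_exists:
  assumes x: "x \<in> pts n"
  shows "\<exists>p l. cycle_start p l \<and> (x, p) \<in> joined\<^sup>*"
proof -
  obtain y where y: "(x, y) \<in> joined\<^sup>*" "\<And>z. (x, z) \<in> joined\<^sup>* \<Longrightarrow> snd y \<le> snd z"
    using ex_has_least_nat[of "\<lambda>y. (x, y) \<in> joined\<^sup>*" x snd] by blast
  have y_pts: "y \<in> pts n"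
    using component_pts[OF y(1) x] .
  define p where "p = (if fst y = 0 then y else flip n y)"
  have "(y, flip n y) \<in> joined"
    unfolding closure_adj_eq using y_pts by blast
  then have xp: "(x, p) \<in> joined\<^sup>*"
    using y(1) by (auto simp: p_def intro: rtrancl.rtrancl_into_rtrancl)
  have p: "p \<in> pts n" "fst p = 0" "snd p = snd y"
    using y_pts flip_apply[OF y_pts] matching_pts[OF matching_flip, of n y]
    by (auto simp: p_def pts_def)
  define l where "l = (LEAST k. 0 < k \<and> (advance ^^ k) p = p)"
  have l: "0 < l" "(advance ^^ l) p = p"
    unfolding l_def using LeastI_ex[OF advance_period[of p]] by auto
  \<comment> \<open>An iterate in the column of \<open>p\<close> would be \<open>p\<close>, against
    the choice of \<open>l\<close>, or the flip of \<open>p\<close>, which the orbit avoids.\<close>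
  have "snd p < snd ((advance ^^ j) p)" if j: "0 < j" "j < l" for j
  proof -
    let ?q = "(advance ^^ j) p"
    have "?q \<noteq> p"
      using not_less_Least[of j "\<lambda>k. 0 < k \<and> (advance ^^ k) p = p"] j unfolding l_def by blast
    moreover have "?q \<noteq> flip n p"
      using advance_pow_neq_flip[OF p(1)] .
    moreover have "?q \<in> pts n"
      using p(1) advance_pow_pts by blast
    ultimately have "snd ?q \<noteq> snd p"
      using p flip_apply[OF p(1)] by (auto simp: pts_def prod_eq_iff)
    moreover have "snd p \<le> snd ?q"
      using y(2) p(3) rtrancl_trans[OF xp advance_component[OF p(1)]] by simp
    ultimately show ?thesis
      by simp
  qed
  then have "cycle_start p l"
    using p l by (simp add: cycle_start_def)
  with xp show ?thesis
    by blast
qed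

lemma card_closure_cycles:
  "card {w. is_closure_cycle (tangle_of n m) w} = closure_loops n (tangle_of n m)"
proof -
  have "bij_betw (\<lambda>w. joined\<^sup>* `` {src w 0}) {w. is_closure_cycle (tangle_of n m) w} (pts n // joined\<^sup>*)"
  proof (rule bij_betw_imageI)
    show "inj_on (\<lambda>w. joined\<^sup>* `` {src w 0}) {w. is_closure_cycle (tangle_of n m) w}"
    proof (rule inj_onI)
      fix w w' :: "unit walk"
      assume w: "w \<in> {w. is_closure_cycle (tangle_of n m) w}" "w' \<in> {w. is_closure_cycle (tangle_of n m) w}"
        and "joined\<^sup>* `` {src w 0} = joined\<^sup>* `` {src w' 0}"
      then have "(src w 0, src w' 0) \<in> joined\<^sup>*"
        by (metis Image_singleton_iff rtrancl.rtrancl_refl)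
      with w cycle_start_of_walk[of w] cycle_start_of_walk[of w'] cycle_start_unique show "w = w'"
        by (metis mem_Collect_eq)
    qed
    show "(\<lambda>w. joined\<^sup>* `` {src w 0}) ` {w. is_closure_cycle (tangle_of n m) w} = pts n // joined\<^sup>*"
    proof (intro equalityI subsetI)
      fix C assume "C \<in> (\<lambda>w. joined\<^sup>* `` {src w 0}) ` {w. is_closure_cycle (tangle_of n m) w}"
      then show "C \<in> pts n // joined\<^sup>*"
        using cycle_start_of_walk by (auto simp: cycle_start_def intro: quotientI)
    next
      fix C assume "C \<in> pts n // joined\<^sup>*"
      then obtain x where x: "x \<in> pts n" "C = joined\<^sup>* `` {x}"
        by (auto elim: quotientE)
      then obtain p l where p: "cycle_start p l" "(x, p) \<in> joined\<^sup>*"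
        using cycle_start_exists by blast
      have "src (orbit_walk p l) 0 = p"
        using p(1) by (simp add: orbit_walk_def cycle_start_def)
      moreover have "C = joined\<^sup>* `` {p}"
        using p(2) joined_sym[OF p(2)] x(2) by (auto intro: rtrancl_trans)
      ultimately show "C \<in> (\<lambda>w. joined\<^sup>* `` {src w 0}) ` {w. is_closure_cycle (tangle_of n m) w}"
        using walk_of_cycle_start[OF p(1)] by (intro image_eqI[of _ _ "orbit_walk p l"]) auto
    qed
  qed
  then show ?thesis
    unfolding closure_loops_def by (rule bij_betw_same_card)
qed

lemma label_sum_closure_cycle:
  assumes w: "is_closure_cycle (tangle_of n m) w"
  shows "label_sum (\<lambda>_. restrict canonical_label (tangle_of n m)) w = 0"
proof -
  have E: "edge w j \<in> tangle_of n m" if "j < length w" for j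
    using w that unfolding is_closure_cycle_def by blast
  have "label_sum (\<lambda>_. restrict canonical_label (tangle_of n m)) w =
    (- 1) ^ fst (src w 0) * (int (snd (tgt w (length w - 1))) - int (snd (src w 0)))"
  proof (rule label_sum_telescope)
    show "w \<noteq> []"
      using w unfolding is_closure_cycle_def by blast
  next
    fix j assume j: "j < length w"
    show "src w j \<noteq> tgt w j \<and> fst (src w j) \<le> 1 \<and> fst (tgt w j) \<le> 1 \<and>
      restrict canonical_label (tangle_of n m) (edge w j) = canonical_label (edge w j)"
      using E[OF j] tangle_of_edge[OF m E[OF j]] by simp
  next
    fix j assume j: "Suc j < length w"
    then have "snd (src w (Suc j)) = snd (tgt w j)"
      "fst (tgt w j) = 0 \<longrightarrow> fst (src w (Suc j)) = 1" "fst (tgt w j) = 1 \<longrightarrow> fst (src w (Suc j)) = 0"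
      using w unfolding is_closure_cycle_def by blast+
    moreover have "fst (tgt w j) = 0 \<or> fst (tgt w j) = 1"
      using tangle_of_edge(3)[OF m E[of j]] j by auto
    ultimately show "snd (src w (Suc j)) = snd (tgt w j) \<and> fst (src w (Suc j)) = 1 - fst (tgt w j)"
      by auto
  qed
  moreover have "snd (src w 0) = snd (tgt w (length w - 1))"
    using w unfolding is_closure_cycle_def by blast
  ultimately show ?thesis
    by simp
qed

lemma arrow_closure_coeff_lift:
  "arrow_closure_coeff (lift n m) = za 0 ^ closure_loops n (tangle_of n m)"
proof -
  have "arrow_closure_coeff (lift n m) = (\<Prod>w\<in>{w. is_closure_cycle (tangle_of n m) w}. za 0)"
    unfolding arrow_closure_coeff_def lift_def prod.case
    by (intro prod.cong) (simp_all add: zeta_def label_sum_closure_cycle del: za.simps)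
  then show ?thesis
    by (simp add: card_closure_cycles del: za.simps)
qed

end

section \<open>Evaluation of words\<close>

lemma basis_algebra_mult_single:
  "Poly_Mapping.single a 1 \<otimes>\<^bsub>basis_algebra B mul e\<^esub> Poly_Mapping.single b d = scale d (mul a b)"
  for mul :: "'k \<Rightarrow> 'k \<Rightarrow> ('k \<Rightarrow>\<^sub>0 'r::comm_ring_1)"
proof -
  have 1: "additive (\<lambda>d. scale (c * d) x)" "additive (\<lambda>c. scale (c * d) x)"
    for c d :: 'r and x :: "'k \<Rightarrow>\<^sub>0 'r"
    by (intro additive_compose[OF additive_scale_left] additive_mult_left additive_mult_right)+
  then show ?thesis
    unfolding basis_algebra_mult by (simp add: linext_single additive_linext_param)
qed

text \<open>The right fold multiplies by one generator at a time from the left, which is the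
  recursion of \<open>act\<close> and \<open>loops\<close>; the product formulas for a generator
  therefore suffice.\<close>

lemma eval_word_VTL:
  assumes "u \<in> lists {1..<n}"
  shows "foldr (\<lambda>i y. Poly_Mapping.single (gen_tangle n i) 1 \<otimes>\<^bsub>VTL n\<^esub> y) u \<one>\<^bsub>VTL n\<^esub>
    = Poly_Mapping.single (tangle_of n (act u (flip n))) (zf ^ loops u (flip n))"
  using assms
proof (induction u)
  case Nil
  show ?case
    by (simp add: VTL_def basis_algebra_def id_tangle_eq)
next
  case (Cons i u)
  then have "matching n (act u (flip n))" "i \<in> {1..<n}"
    using matching_act[OF matching_flip] by auto
  then show ?case
    using Cons by (simp add: VTL_def basis_algebra_mult_single scale_single tangle_star_gen
        glue_loops_gen power_add mult.commute)
qed

lemma Rf_to_Ra_hom: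
  "Rf_to_Ra 0 = 0" "Rf_to_Ra 1 = 1" "Rf_to_Ra (c + d) = Rf_to_Ra c + Rf_to_Ra d"
  "Rf_to_Ra (c * d) = Rf_to_Ra c * Rf_to_Ra d"
  by (simp_all add: Rf_to_Ra_def single_add mult_single)

lemma Rf_to_Ra_power: "Rf_to_Ra (c ^ k) = Rf_to_Ra c ^ k"
  by (induction k) (simp_all add: Rf_to_Ra_hom)

lemma additive_Rf_to_Ra: "additive Rf_to_Ra"
  by (simp add: additive_def Rf_to_Ra_hom)

lemma eval_word_ATL:
  assumes "u \<in> lists {1..<n}"
  shows "foldr (\<lambda>i y. Poly_Mapping.single (gen_arrow_tangle n i) 1 \<otimes>\<^bsub>ATL n\<^esub> y) u \<one>\<^bsub>ATL n\<^esub>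
    = Poly_Mapping.single (lift n (act u (flip n))) (Rf_to_Ra (zf ^ loops u (flip n)))"
  using assms
proof (induction u)
  case Nil
  show ?case
    by (simp add: ATL_def basis_algebra_def id_arrow_tangle_eq Rf_to_Ra_hom)
next
  case (Cons i u)
  then have "matching n (act u (flip n))" "i \<in> {1..<n}"
    using matching_act[OF matching_flip] by auto
  then show ?case
    using Cons by (simp add: ATL_def basis_algebra_mult_single scale_single arrow_star_gen
        arrow_coeff_gen power_add Rf_to_Ra_hom Rf_to_Ra_power)
qed

text \<open>With \<open>ATL_of\<close>, the second half of a common factorisation: both evaluations
  of words pass through the same combination of matchings.\<close>

definition VTL_of :: "nat \<Rightarrow> ((pt \<Rightarrow> pt) \<Rightarrow>\<^sub>0 Rf) \<Rightarrow> (tangle \<Rightarrow>\<^sub>0 Rf)" where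
  "VTL_of n = linext (\<lambda>m. Poly_Mapping.single (tangle_of n m))"

definition ATL_of :: "nat \<Rightarrow> ((pt \<Rightarrow> pt) \<Rightarrow>\<^sub>0 Rf) \<Rightarrow> (arrow_tangle \<Rightarrow>\<^sub>0 Ra)" where
  "ATL_of n = linext (\<lambda>m c. Poly_Mapping.single (lift n m) (Rf_to_Ra c))"

lemma additive_VTL_of: "additive (VTL_of n)"
  unfolding VTL_of_def by (intro additive_linext additive_single)

lemma additive_single_Rf_to_Ra: "additive (\<lambda>c. Poly_Mapping.single k (Rf_to_Ra c))"
  by (rule additive_compose[OF additive_single additive_Rf_to_Ra])

lemma additive_ATL_of: "additive (ATL_of n)"
  unfolding ATL_of_def by (intro additive_linext additive_single_Rf_to_Ra)

lemma eval_poly_eq_linext: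
  "eval_poly \<phi> A g = linext (\<lambda>u c. scale (\<phi> c) (foldr (\<lambda>i y. g i \<otimes>\<^bsub>A\<^esub> y) u \<one>\<^bsub>A\<^esub>))"
  by (simp add: fun_eq_iff eval_poly_def linext_def)

lemma eval_poly_VTL:
  assumes "Poly_Mapping.keys p \<subseteq> lists {1..<n}"
  shows "eval_poly (\<lambda>c. c) (VTL n) (\<lambda>i. Poly_Mapping.single (gen_tangle n i) 1) p
    = VTL_of n (word_action p (flip n))"
proof (rule additive_eqI[OF _ _ assms])
  show "additive (eval_poly (\<lambda>c. c) (VTL n) (\<lambda>i. Poly_Mapping.single (gen_tangle n i) 1))"
    unfolding eval_poly_eq_linext by (intro additive_linext additive_scale_left)
  show "additive (\<lambda>p. VTL_of n (word_action p (flip n)))"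
    by (rule additive_compose[OF additive_VTL_of additive_word_action])
  fix u c assume "u \<in> lists {1..<n}"
  then show "eval_poly (\<lambda>c. c) (VTL n) (\<lambda>i. Poly_Mapping.single (gen_tangle n i) 1) (Poly_Mapping.single u c)
      = VTL_of n (word_action (Poly_Mapping.single u c) (flip n))"
    unfolding eval_poly_eq_linext linext_single[OF additive_scale_left]
    by (simp add: eval_word_VTL scale_single word_action_single VTL_of_def linext_single additive_single)
qed

lemma eval_poly_ATL:
  assumes "Poly_Mapping.keys p \<subseteq> lists {1..<n}"
  shows "eval_poly Rf_to_Ra (ATL n) (\<lambda>i. Poly_Mapping.single (gen_arrow_tangle n i) 1) p
    = ATL_of n (word_action p (flip n))"
proof (rule additive_eqI[OF _ _ assms])
  have scale: "additive (\<lambda>c. scale (Rf_to_Ra c) x)" for x :: "arrow_tangle \<Rightarrow>\<^sub>0 Ra"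
    by (rule additive_compose[OF additive_scale_left additive_Rf_to_Ra])
  show "additive (eval_poly Rf_to_Ra (ATL n) (\<lambda>i. Poly_Mapping.single (gen_arrow_tangle n i) 1))"
    unfolding eval_poly_eq_linext by (intro additive_linext scale)
  show "additive (\<lambda>p. ATL_of n (word_action p (flip n)))"
    by (rule additive_compose[OF additive_ATL_of additive_word_action])
  fix u c assume "u \<in> lists {1..<n}"
  then show "eval_poly Rf_to_Ra (ATL n) (\<lambda>i. Poly_Mapping.single (gen_arrow_tangle n i) 1) (Poly_Mapping.single u c)
      = ATL_of n (word_action (Poly_Mapping.single u c) (flip n))"
    unfolding eval_poly_eq_linext linext_single[OF scale]
    by (simp add: eval_word_ATL scale_single word_action_single ATL_of_def linext_single
        additive_single_Rf_to_Ra Rf_to_Ra_hom)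
qed

text \<open>On one matching both sides are the coefficient times the same power of
  \<open>za 0\<close>, the image of \<open>zf\<close>. The support condition is needed because
  cycles were counted only for matchings.\<close>

lemma trace_a_ATL_of:
  assumes "Poly_Mapping.keys y \<subseteq> Collect (matching n)"
  shows "trace_a n (ATL_of n y) = Rf_to_Ra (trace_f n (VTL_of n y))"
proof (rule additive_eqI[OF _ _ assms])
  have tr: "trace_a n = linext (\<lambda>F c. c * arrow_closure_coeff F)"
    "trace_f n = linext (\<lambda>E c. c * zf ^ closure_loops n E)"
    by (simp_all add: fun_eq_iff trace_a_def trace_f_def linext_def)
  have a: "additive (trace_a n)" and f: "additive (trace_f n)"
    unfolding tr by (intro additive_linext additive_mult_right)+
  show "additive (\<lambda>y. trace_a n (ATL_of n y))"
    by (rule additive_compose[OF a additive_ATL_of])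
  show "additive (\<lambda>y. Rf_to_Ra (trace_f n (VTL_of n y)))"
    by (rule additive_compose[OF additive_Rf_to_Ra additive_compose[OF f additive_VTL_of]])
  fix m c assume "m \<in> Collect (matching n)"
  then show "trace_a n (ATL_of n (Poly_Mapping.single m c))
      = Rf_to_Ra (trace_f n (VTL_of n (Poly_Mapping.single m c)))"
    by (simp add: tr ATL_of_def VTL_of_def linext_single additive_single_Rf_to_Ra additive_single
        additive_mult_right arrow_closure_coeff_lift Rf_to_Ra_hom Rf_to_Ra_power)
qed

lemma the_elem_image_const: "a \<in> X \<Longrightarrow> (\<And>x. x \<in> X \<Longrightarrow> f x = c) \<Longrightarrow> the_elem (f ` X) = c"
  by (metis image_constant image_cong the_elem_eq)

theorem proposition3p7:
  fixes n :: nat and x :: "(nat list \<Rightarrow>\<^sub>0 Rf) set"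
  assumes "n \<ge> 1" and "x \<in> carrier (TL n)"
  shows "trace_a n (iota n x) = Rf_to_Ra (trace_f n (TL_to_VTL n x))"
proof -
  obtain p where p: "p \<in> x" "Poly_Mapping.keys p \<subseteq> lists {1..<n}"
    and x: "\<And>q. q \<in> x \<Longrightarrow> Poly_Mapping.keys q \<subseteq> lists {1..<n} \<and>
      (\<forall>m. matching n m \<longrightarrow> word_action q m = word_action p m)"
    using TL_coset[OF assms(2)] by blast
  \<comment> \<open>Evaluating a word in an algebra means letting it act on the unit, whose matching
    is \<open>flip n\<close>.\<close>
  let ?y = "word_action p (flip n)"
  have "TL_to_VTL n x = VTL_of n ?y"
    unfolding TL_to_VTL_def TL_hom_def
    by (rule the_elem_image_const[OF p(1)]) (use x eval_poly_VTL matching_flip in metis)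
  moreover have "iota n x = ATL_of n ?y"
    unfolding iota_def TL_hom_def
    by (rule the_elem_image_const[OF p(1)]) (use x eval_poly_ATL matching_flip in metis)
  ultimately show ?thesis
    using trace_a_ATL_of[OF keys_word_action[OF matching_flip p(2)]] by simp
qed

end
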